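(* Let $F\in C^3(\Omega)$ and let $u:[t_0,T]\to\mathbb{R}$ be the unique solution of $u'(t)=F(t,u(t))$, $t\in(t_0,T)$, $u(t_0)=u_0$. Suppose that there exist constants $\rho>0$ and $L\ge0$ such that $U_\rho(u)\subset\Omega$ and $|F(t,x)-F(t,y)|\le L|x-y|$ whenever $(t,x),(t,y)\in U_\rho(u)$. Suppose further that $$0<F(t,x)\,\mathcal{L}_F^2F(t,x)<3\bigl(\mathcal{L}_FF(t,x)\bigr)^2$$ for every $(t,x)\in U_\rho(u)$. Define $\Sigma:U_\rho(u)\to(0,\infty)$ by $$\Sigma(t,x):=\left(\frac{3F(t,x)\bigl(\mathcal{L}_FF(t,x)\bigr)^2}{\mathcal{L}_F^2F(t,x)}-F(t,x)^2\right)^{1/2}.$$ Consider the specular ellipse method with $\sigma_n:=\Sigma(t_n,u_n)$, $n=0,1,\ldots,N_h-1$. Then there exist constants $H>0$ and $C_g>0$ such that, for every $h\in(0,H]$, there exists a unique sequence $\{u_n\}_{n=0}^{N_h}$ with $u_0=u(t_0)$ satisfying $$u_{n+1}=u_n+h\,\mathcal{C}_{\sigma_n}\bigl(F(t_{n+1},u_{n+1}),F(t_n,u_n)\bigr),\qquad n=0,1,\ldots,N_h-1,$$ with $\{(t_n,u_n)\}_{n=0}^{N_h}\subseteq U_\rho(u)$, and the estimate $$\max_{0\le n\le N_h}|u(t_n)-u_n|\le C_gh^3$$ holds.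
   Context: Let $\Omega\subset\mathbb{R}^2$ be open, $F:\Omega\to\mathbb{R}$, $t_0\ge 0$, $T>t_0$, $u_0\in\mathbb{R}$ with $(t_0,u_0)\in\Omega$. A solution $u:[t_0,T]\to\mathbb{R}$ is continuous on $[t_0,T]$ and satisfies $(t,u(t))\in\Omega$ for every $t\in[t_0,T]$. For $\rho>0$, $U_\rho(u):=\{(t,x)\in[t_0,T]\times\mathbb{R}: |x-u(t)|\le\rho\}$. For $h>0$ put $N_h:=\lfloor h^{-1}(T-t_0)\rfloor$ and $t_n:=t_0+nh$. For $G\in C^1(\Omega)$, $\mathcal{L}_FG:=G_t+FG_x$; for $G\in C^2(\Omega)$, $\mathcal{L}_F^2G:=\mathcal{L}_F(\mathcal{L}_FG)$. For $\sigma>0$ define $\mathcal{C}_\sigma(\alpha,\beta):=\sigma\,\mathcal{C}(\alpha/\sigma,\beta/\sigma)$, where $$\mathcal{C}(\alpha,\beta):=\left(\frac{\alpha}{\sqrt{1+\alpha^2}}+\frac{\beta}{\sqrt{1+\beta^2}}\right)\left(\frac{1}{\sqrt{1+\alpha^2}}+\frac{1}{\sqrt{1+\beta^2}}\right)^{-1}.$$ The specular ellipse method with positive scales $\{\sigma_n\}$ is the implicit one-step method displayed in the claim. *)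

theory Defs
  imports "HOL-Analysis.Analysis"
begin

definition partial_t :: "(real \<times> real \<Rightarrow> real) \<Rightarrow> real \<times> real \<Rightarrow> real" where
  "partial_t G = (\<lambda>(t, x). deriv (\<lambda>s. G (s, x)) t)"

definition partial_x :: "(real \<times> real \<Rightarrow> real) \<Rightarrow> real \<times> real \<Rightarrow> real" where
  "partial_x G = (\<lambda>(t, x). deriv (\<lambda>y. G (t, y)) x)"

text \<open>
  \<open>C_on k \<Omega> G\<close> is \<open>G \<in> C\<^sup>k(\<Omega>)\<close> for an open set \<open>\<Omega>\<close>: all partial derivatives of order at most
  \<open>k\<close> exist and are continuous on \<open>\<Omega>\<close>. Existence is required explicitly because \<^const>\<open>deriv\<close>
  is total. Values of \<open>G\<close> outside the open set \<open>\<Omega>\<close> are irrelevant.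
\<close>
primrec C_on :: "nat \<Rightarrow> (real \<times> real) set \<Rightarrow> (real \<times> real \<Rightarrow> real) \<Rightarrow> bool" where
  "C_on 0 \<Omega> G \<longleftrightarrow> continuous_on \<Omega> G"
| "C_on (Suc k) \<Omega> G \<longleftrightarrow>
     continuous_on \<Omega> G \<and>
     (\<forall>(t, x) \<in> \<Omega>. (\<lambda>s. G (s, x)) field_differentiable (at t) \<and>
                    (\<lambda>y. G (t, y)) field_differentiable (at x)) \<and>
     C_on k \<Omega> (partial_t G) \<and> C_on k \<Omega> (partial_x G)"

definition Lie :: "(real \<times> real \<Rightarrow> real) \<Rightarrow> (real \<times> real \<Rightarrow> real) \<Rightarrow> real \<times> real \<Rightarrow> real" where
  "Lie F G = (\<lambda>p. partial_t G p + F p * partial_x G p)"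

definition ivp_solution ::
  "(real \<times> real) set \<Rightarrow> (real \<times> real \<Rightarrow> real) \<Rightarrow> real \<Rightarrow> real \<Rightarrow> real \<Rightarrow> (real \<Rightarrow> real) \<Rightarrow> bool" where
  "ivp_solution \<Omega> F t0 T u0 u \<longleftrightarrow>
     continuous_on {t0..T} u \<and>
     (\<forall>t\<in>{t0..T}. (t, u t) \<in> \<Omega>) \<and>
     (\<forall>t\<in>{t0<..<T}. (u has_real_derivative F (t, u t)) (at t)) \<and>
     u t0 = u0"

text \<open>Functions on \<open>[t\<^sub>0, T]\<close> are represented by total functions, so uniqueness is
  equality on the interval.\<close>
definition unique_ivp_solution ::
  "(real \<times> real) set \<Rightarrow> (real \<times> real \<Rightarrow> real) \<Rightarrow> real \<Rightarrow> real \<Rightarrow> real \<Rightarrow> (real \<Rightarrow> real) \<Rightarrow> bool" where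
  "unique_ivp_solution \<Omega> F t0 T u0 u \<longleftrightarrow>
     ivp_solution \<Omega> F t0 T u0 u \<and>
     (\<forall>v. ivp_solution \<Omega> F t0 T u0 v \<longrightarrow> (\<forall>t\<in>{t0..T}. v t = u t))"

definition tube :: "real \<Rightarrow> real \<Rightarrow> real \<Rightarrow> (real \<Rightarrow> real) \<Rightarrow> (real \<times> real) set" where
  "tube t0 T \<rho> u = {(t, x). t \<in> {t0..T} \<and> \<bar>x - u t\<bar> \<le> \<rho>}"

definition num_steps :: "real \<Rightarrow> real \<Rightarrow> real \<Rightarrow> nat" where
  "num_steps t0 T h = nat \<lfloor>(T - t0) / h\<rfloor>"

definition grid :: "real \<Rightarrow> real \<Rightarrow> nat \<Rightarrow> real" where
  "grid t0 h n = t0 + real n * h"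

definition spec_mean :: "real \<Rightarrow> real \<Rightarrow> real" where
  "spec_mean \<alpha> \<beta> =
     (\<alpha> / sqrt (1 + \<alpha>\<^sup>2) + \<beta> / sqrt (1 + \<beta>\<^sup>2)) * inverse (1 / sqrt (1 + \<alpha>\<^sup>2) + 1 / sqrt (1 + \<beta>\<^sup>2))"

definition spec_mean_scaled :: "real \<Rightarrow> real \<Rightarrow> real \<Rightarrow> real" where
  "spec_mean_scaled \<sigma> \<alpha> \<beta> = \<sigma> * spec_mean (\<alpha> / \<sigma>) (\<beta> / \<sigma>)"

definition specular_ellipse_method ::
  "(real \<times> real \<Rightarrow> real) \<Rightarrow> real \<Rightarrow> real \<Rightarrow> nat \<Rightarrow> (nat \<Rightarrow> real) \<Rightarrow> (nat \<Rightarrow> real) \<Rightarrow> bool" where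
  "specular_ellipse_method F t0 h N \<sigma> w \<longleftrightarrow>
     (\<forall>n<N. w (Suc n) = w n + h * spec_mean_scaled (\<sigma> n)
        (F (grid t0 h (Suc n), w (Suc n))) (F (grid t0 h n, w n)))"

text \<open>Where \<open>0 < F * Lie F (Lie F F) < 3 * (Lie F F)\<^sup>2\<close> holds, the radicand equals
  \<open>F\<^sup>2 * (3 * (Lie F F)\<^sup>2 / (F * Lie F (Lie F F)) - 1)\<close> and is positive.\<close>
definition opt_scale :: "(real \<times> real \<Rightarrow> real) \<Rightarrow> real \<times> real \<Rightarrow> real" where
  "opt_scale F p = sqrt (3 * F p * (Lie F F p)\<^sup>2 / Lie F (Lie F F) p - (F p)\<^sup>2)"

end

theory Submission
  imports Defs
begin

text \<open>
  Rationalising gives \<open>C\<^sub>\<sigma>(a, b) = m - (a - b)\<^sup>2 m / (A + B)\<^sup>2\<close> with \<open>m = (a + b) / 2\<close>,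
  \<open>A = sqrt (\<sigma>\<^sup>2 + a\<^sup>2)\<close> and \<open>B = sqrt (\<sigma>\<^sup>2 + b\<^sup>2)\<close>: the trapezoidal rule plus a quadratic correction.
  Along the solution \<open>f t = F (t, u t)\<close> has derivatives \<open>f' = L\<^sub>F F\<close> and \<open>f'' = L\<^sub>F\<^sup>2 F\<close>, the
  trapezoidal rule errs by \<open>h\<^sup>3 f'' / 12\<close> and the correction contributes \<open>h\<^sup>3 f f'\<^sup>2 / (4 (\<sigma>\<^sup>2 + f\<^sup>2))\<close>
  up to \<open>O(h\<^sup>4)\<close>; the two cancel precisely for \<open>\<sigma> = \<Sigma>\<close>.  On the compact tube \<open>\<Sigma>\<close> is bounded
  below and Lipschitz in \<open>x\<close>, so the increment is Lipschitz in \<open>(u\<^sub>n, u\<^sub>n\<^sub>+\<^sub>1)\<close>.  Each implicit step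
  is then solved by a contraction, and a discrete Gronwall argument turns the local error \<open>O(h\<^sup>4)\<close>
  into the global error \<open>O(h\<^sup>3)\<close>, which also keeps the iterates in the tube.
\<close>

section \<open>Calculus of \<open>C_on\<close> and of the Lie derivative\<close>

lemma eventually_slice_fst:
  fixes \<Omega> :: "(real \<times> real) set"
  assumes "open \<Omega>" "(t, x) \<in> \<Omega>"
  shows "eventually (\<lambda>s. (s, x) \<in> \<Omega>) (nhds t)"
proof -
  have "open ((\<lambda>s. (s, x)) -` \<Omega>)"
    by (intro open_vimage assms continuous_intros)
  then show ?thesis
    using assms(2) by (auto simp: eventually_nhds)
qed

lemma eventually_slice_snd:
  fixes \<Omega> :: "(real \<times> real) set"
  assumes "open \<Omega>" "(t, x) \<in> \<Omega>"
  shows "eventually (\<lambda>y. (t, y) \<in> \<Omega>) (nhds x)"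
proof -
  have "open ((\<lambda>y. (t, y)) -` \<Omega>)"
    by (intro open_vimage assms continuous_intros)
  then show ?thesis
    using assms(2) by (auto simp: eventually_nhds)
qed

lemma C_on_continuous: "C_on k \<Omega> G \<Longrightarrow> continuous_on \<Omega> G"
  by (cases k) auto

lemma C_on_SucD: "C_on (Suc k) \<Omega> G \<Longrightarrow> C_on k \<Omega> G"
proof (induction k arbitrary: G)
  case (Suc k)
  have "C_on (Suc k) \<Omega> (partial_t G)" "C_on (Suc k) \<Omega> (partial_x G)"
    using Suc.prems by (auto simp only: C_on.simps(2)[of "Suc k"])
  from this[THEN Suc.IH] show ?case
    using Suc.prems by simp
qed simp

lemma C_on_partial_t:
  assumes "C_on (Suc k) \<Omega> G" "(t, x) \<in> \<Omega>"
  shows "((\<lambda>s. G (s, x)) has_real_derivative partial_t G (t, x)) (at t)"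
  using assms by (auto simp: partial_t_def field_differentiable_derivI)

lemma C_on_partial_x:
  assumes "C_on (Suc k) \<Omega> G" "(t, x) \<in> \<Omega>"
  shows "((\<lambda>y. G (t, y)) has_real_derivative partial_x G (t, x)) (at x)"
  using assms by (auto simp: partial_x_def field_differentiable_derivI)

lemma partial_t_eqI:
  "((\<lambda>s. G (s, x)) has_real_derivative D) (at t) \<Longrightarrow> partial_t G (t, x) = D"
  by (simp add: partial_t_def DERIV_imp_deriv)

lemma partial_x_eqI:
  "((\<lambda>y. G (t, y)) has_real_derivative D) (at x) \<Longrightarrow> partial_x G (t, x) = D"
  by (simp add: partial_x_def DERIV_imp_deriv)

text \<open>Openness of \<open>\<Omega>\<close> makes \<open>G\<close> and \<open>H\<close> agree
  near each point along both axes, so their partial derivatives agree on \<open>\<Omega>\<close> and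
  the induction applies to those. This lets explicit derivative formulas, valid on
  \<open>\<Omega>\<close> only, stand in for the \<open>deriv\<close>-based \<open>partial_t\<close>
  and \<open>partial_x\<close>.\<close>

lemma C_on_cong:
  assumes "open \<Omega>"
  shows "C_on k \<Omega> G \<Longrightarrow> (\<And>p. p \<in> \<Omega> \<Longrightarrow> G p = H p) \<Longrightarrow> C_on k \<Omega> H"
proof (induction k arbitrary: G H)
  case 0
  then show ?case
    by (auto cong: continuous_on_cong)
next
  case (Suc k)
  have der_t: "((\<lambda>s. H (s, x)) has_real_derivative partial_t G (t, x)) (at t)"
    if "(t, x) \<in> \<Omega>" for t x
  proof -
    have ev: "eventually (\<lambda>s. G (s, x) = H (s, x)) (nhds t)"
      using eventually_slice_fst[OF assms that] by eventually_elim (rule Suc.prems(2))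
    show ?thesis
      using C_on_partial_t[OF Suc.prems(1) that] DERIV_cong_ev[OF refl ev refl] by simp
  qed
  have der_x: "((\<lambda>y. H (t, y)) has_real_derivative partial_x G (t, x)) (at x)"
    if "(t, x) \<in> \<Omega>" for t x
  proof -
    have ev: "eventually (\<lambda>y. G (t, y) = H (t, y)) (nhds x)"
      using eventually_slice_snd[OF assms that] by eventually_elim (rule Suc.prems(2))
    show ?thesis
      using C_on_partial_x[OF Suc.prems(1) that] DERIV_cong_ev[OF refl ev refl] by simp
  qed
  have "continuous_on \<Omega> H"
    using C_on_continuous[OF Suc.prems(1)] Suc.prems(2) by (auto cong: continuous_on_cong)
  moreover have "C_on k \<Omega> (partial_t H)"
    by (rule Suc.IH[of "partial_t G"])
      (use Suc.prems(1) partial_t_eqI[OF der_t] in auto)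
  moreover have "C_on k \<Omega> (partial_x H)"
    by (rule Suc.IH[of "partial_x G"])
      (use Suc.prems(1) partial_x_eqI[OF der_x] in auto)
  moreover have "(\<lambda>s. H (s, x)) field_differentiable (at t) \<and> (\<lambda>y. H (t, y)) field_differentiable (at x)"
    if "(t, x) \<in> \<Omega>" for t x
    unfolding field_differentiable_def using der_t[OF that] der_x[OF that] by blast
  ultimately show ?case
    by auto
qed

text \<open>Introduction rule with freely named partial derivatives \<open>Gt\<close> and
  \<open>Gx\<close>: they coincide with \<open>partial_t G\<close> and \<open>partial_x G\<close> on
  \<open>\<Omega>\<close>, and \<open>C_on_cong\<close> transfers their regularity.\<close>

lemma C_on_SucI:
  assumes "open \<Omega>" "continuous_on \<Omega> G"
    and "\<And>t x. (t, x) \<in> \<Omega> \<Longrightarrow> ((\<lambda>s. G (s, x)) has_real_derivative Gt (t, x)) (at t)"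
    and "\<And>t x. (t, x) \<in> \<Omega> \<Longrightarrow> ((\<lambda>y. G (t, y)) has_real_derivative Gx (t, x)) (at x)"
    and "C_on k \<Omega> Gt" "C_on k \<Omega> Gx"
  shows "C_on (Suc k) \<Omega> G"
proof -
  have "C_on k \<Omega> (partial_t G)"
    by (rule C_on_cong[OF assms(1,5)])
      (use partial_t_eqI[OF assms(3)] in auto)
  moreover have "C_on k \<Omega> (partial_x G)"
    by (rule C_on_cong[OF assms(1,6)])
      (use partial_x_eqI[OF assms(4)] in auto)
  moreover have "(\<lambda>s. G (s, x)) field_differentiable (at t) \<and> (\<lambda>y. G (t, y)) field_differentiable (at x)"
    if "(t, x) \<in> \<Omega>" for t x
    unfolding field_differentiable_def using assms(3,4)[OF that] by blast
  ultimately show ?thesis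
    using assms(2) by auto
qed

lemma C_on_add:
  assumes "open \<Omega>"
  shows "C_on k \<Omega> G \<Longrightarrow> C_on k \<Omega> H \<Longrightarrow> C_on k \<Omega> (\<lambda>p. G p + H p)"
proof (induction k arbitrary: G H)
  case 0
  then show ?case
    by (auto intro: continuous_intros)
next
  case (Suc k)
  show ?case
  proof (rule C_on_SucI[OF assms,
        where Gt = "\<lambda>p. partial_t G p + partial_t H p" and Gx = "\<lambda>p. partial_x G p + partial_x H p"])
    show "continuous_on \<Omega> (\<lambda>p. G p + H p)"
      using Suc.prems by (auto intro: continuous_intros)
    show "C_on k \<Omega> (\<lambda>p. partial_t G p + partial_t H p)"
      "C_on k \<Omega> (\<lambda>p. partial_x G p + partial_x H p)"
      using Suc.prems by (auto intro!: Suc.IH)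
  next
    fix t x assume p: "(t, x) \<in> \<Omega>"
    note D = Suc.prems[THEN C_on_partial_t, OF p] Suc.prems[THEN C_on_partial_x, OF p]
    show "((\<lambda>s. G (s, x) + H (s, x)) has_real_derivative
        partial_t G (t, x) + partial_t H (t, x)) (at t)"
      by (intro DERIV_add D)
    show "((\<lambda>y. G (t, y) + H (t, y)) has_real_derivative
        partial_x G (t, x) + partial_x H (t, x)) (at x)"
      by (intro DERIV_add D)
  qed
qed

lemma C_on_mult:
  assumes "open \<Omega>"
  shows "C_on k \<Omega> G \<Longrightarrow> C_on k \<Omega> H \<Longrightarrow> C_on k \<Omega> (\<lambda>p. G p * H p)"
proof (induction k arbitrary: G H)
  case 0
  then show ?case
    by (auto intro: continuous_intros)
next
  case (Suc k)
  show ?case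
  proof (rule C_on_SucI[OF assms,
        where Gt = "\<lambda>p. partial_t G p * H p + partial_t H p * G p"
          and Gx = "\<lambda>p. partial_x G p * H p + partial_x H p * G p"])
    show "continuous_on \<Omega> (\<lambda>p. G p * H p)"
      using Suc.prems by (auto intro: continuous_intros)
  next
    fix t x assume p: "(t, x) \<in> \<Omega>"
    note D = Suc.prems[THEN C_on_partial_t, OF p] Suc.prems[THEN C_on_partial_x, OF p]
    show "((\<lambda>s. G (s, x) * H (s, x)) has_real_derivative
        partial_t G (t, x) * H (t, x) + partial_t H (t, x) * G (t, x)) (at t)"
      by (intro DERIV_mult D)
    show "((\<lambda>y. G (t, y) * H (t, y)) has_real_derivative
        partial_x G (t, x) * H (t, x) + partial_x H (t, x) * G (t, x)) (at x)"
      by (intro DERIV_mult D)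
  next
    \<comment> \<open>The product rule leaves undifferentiated factors, so \<open>G\<close> and
      \<open>H\<close> themselves are lowered to order \<open>k\<close>.\<close>
    have "C_on k \<Omega> G" "C_on k \<Omega> H"
      using Suc.prems by (auto dest: C_on_SucD simp del: C_on.simps)
    then show "C_on k \<Omega> (\<lambda>p. partial_t G p * H p + partial_t H p * G p)"
      "C_on k \<Omega> (\<lambda>p. partial_x G p * H p + partial_x H p * G p)"
      using Suc.prems by (auto intro!: C_on_add[OF assms] Suc.IH)
  qed
qed

lemma C_on_Lie:
  assumes "open \<Omega>" "C_on k \<Omega> F" "C_on (Suc k) \<Omega> G"
  shows "C_on k \<Omega> (Lie F G)"
  unfolding Lie_def using assms by (intro C_on_add C_on_mult) auto

text \<open>The chain rule along the curve needs total differentiability of \<open>G\<close>,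
  whereas \<open>C_on\<close> supplies partial derivatives; continuity of \<open>partial_x G\<close>
  bridges the gap. Since u' = F, the outcome is the Lie derivative, so repeated differentiation
  along the solution iterates \<open>Lie F\<close>.\<close>

lemma has_derivative_along_solution:
  assumes "open \<Omega>" "C_on (Suc k) \<Omega> G" "(t, u t) \<in> \<Omega>"
    and u: "(u has_real_derivative F (t, u t)) (at t)"
  shows "((\<lambda>s. G (s, u s)) has_real_derivative Lie F G (t, u t)) (at t)"
proof -
  obtain A B where "open A" "open B" "(t, u t) \<in> A \<times> B" "A \<times> B \<subseteq> \<Omega>"
    by (rule open_prod_elim[OF assms(1,3)])
  then have AB: "open A" "open B" "t \<in> A" "u t \<in> B" "A \<times> B \<subseteq> \<Omega>"
    by auto
  obtain e where e: "e > 0" "ball (u t) e \<subseteq> B"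
    using AB openE by blast
  \<comment> \<open>A ball is taken because \<open>has_derivative_partialsI\<close> wants a convex
    second factor.\<close>
  define Y where "Y = ball (u t) e"
  have sub: "A \<times> Y \<subseteq> \<Omega>" using AB e by (auto simp: Y_def)
  have "((\<lambda>(x, y). G (x, y)) has_derivative
      (\<lambda>(tx, ty). partial_t G (t, u t) * tx + blinfun_scaleR_right (partial_x G (t, u t)) ty))
      (at (t, u t) within A \<times> Y)"
  proof (rule has_derivative_partialsI[where fy = "\<lambda>x y. blinfun_scaleR_right (partial_x G (x, y))"])
    show "((\<lambda>x. G (x, u t)) has_derivative (*) (partial_t G (t, u t))) (at t within A)"
      using C_on_partial_t[OF assms(2,3)]
      by (simp add: has_field_derivative_def has_derivative_at_withinI)
    show "((\<lambda>y. G (x, y)) has_derivative blinfun_apply (blinfun_scaleR_right (partial_x G (x, y))))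
        (at y within Y)" if "x \<in> A" "y \<in> Y" for x y
    proof -
      have "(x, y) \<in> \<Omega>" using sub that by auto
      from C_on_partial_x[OF assms(2) this] show ?thesis
        by (simp add: has_field_derivative_def has_derivative_at_withinI real_scaleR_def[abs_def])
    qed
    have "continuous_on (A \<times> Y) (\<lambda>p. blinfun_scaleR_right (partial_x G p) :: real \<Rightarrow>\<^sub>L real)"
      using assms(2) sub by (auto intro!: continuous_intros intro: C_on_continuous continuous_on_subset)
    then show "continuous (at (t, u t) within A \<times> Y)
        (\<lambda>(x, y). blinfun_scaleR_right (partial_x G (x, y)) :: real \<Rightarrow>\<^sub>L real)"
      using AB(3) e(1) by (auto simp: continuous_on_eq_continuous_within Y_def case_prod_unfold)
  qed (use e in \<open>auto simp: Y_def\<close>)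
  then have G: "(G has_derivative (\<lambda>(tx, ty). partial_t G (t, u t) * tx + partial_x G (t, u t) * ty))
      (at (t, u t))"
    using at_within_open[of "(t, u t)" "A \<times> Y"] AB(1,3) e(1) by (simp add: open_Times Y_def)
  have "((\<lambda>s. (s, u s)) has_derivative (\<lambda>s. (s, F (t, u t) * s))) (at t)"
    using u by (auto intro!: derivative_eq_intros simp: has_field_derivative_def)
  from has_derivative_compose[OF this G]
  have "((\<lambda>s. G (s, u s)) has_derivative
      (\<lambda>s. partial_t G (t, u t) * s + partial_x G (t, u t) * (F (t, u t) * s))) (at t)"
    by simp
  also have "(\<lambda>s. partial_t G (t, u t) * s + partial_x G (t, u t) * (F (t, u t) * s)) =
      (*) (Lie F G (t, u t))"
    by (simp add: fun_eq_iff Lie_def algebra_simps)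
  finally show ?thesis
    by (simp add: has_field_derivative_def)
qed

section \<open>Taylor expansion along the solution\<close>

text \<open>The mean value theorem raises the order of a bound by one. Compared with integration it
  loses the factor 1/(k+1), which is harmless here.\<close>

lemma abs_increment_le:
  fixes g g' :: "real \<Rightarrow> real"
  assumes "continuous_on {a..b} g" "a \<le> t" "t \<le> b"
    and der: "\<And>s. a < s \<Longrightarrow> s < b \<Longrightarrow> (g has_real_derivative g' s) (at s)"
    and bound: "\<And>s. a < s \<Longrightarrow> s < b \<Longrightarrow> \<bar>g' s\<bar> \<le> C * (s - a) ^ k"
    and "0 \<le> C"
  shows "\<bar>g t - g a\<bar> \<le> C * (t - a) ^ Suc k"
proof (cases "a = t")
  case False
  then have "a < t" using assms by simp
  have "continuous_on {a..t} g"
    using assms(1,3) by (auto intro: continuous_on_subset)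
  moreover have "g differentiable (at s)" if "a < s" "s < t" for s
    using der[of s] that assms(3) real_differentiable_def by force
  ultimately obtain l z where z: "a < z" "z < t" "(g has_real_derivative l) (at z)"
    "g t - g a = (t - a) * l"
    using MVT[OF \<open>a < t\<close>] by blast
  have "l = g' z"
    using der[of z] z assms(3) DERIV_unique by force
  then have "\<bar>g t - g a\<bar> = (t - a) * \<bar>g' z\<bar>"
    using z \<open>a < t\<close> by (simp add: abs_mult)
  also have "\<dots> \<le> (t - a) * (C * (z - a) ^ k)"
    using bound[of z] z assms(3) \<open>a < t\<close> by (intro mult_left_mono) auto
  also have "\<dots> \<le> (t - a) * (C * (t - a) ^ k)"
    using z \<open>0 \<le> C\<close> by (intro mult_left_mono power_mono) auto
  finally show ?thesis by (simp add: algebra_simps)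
qed (use assms in simp)

text \<open>The remainders form a chain: v' = g, g' = g1 and g1' = f2 - f2(a), and each vanishes at
  \<open>a\<close>. Four uses of \<open>abs_increment_le\<close>, starting from the bound on
  \<open>f3\<close>, gain one power of the step each. Derivatives are taken in the open interval and
  continuity covers the ends, which suits steps touching the ends of the time interval.\<close>

lemma taylor_bounds:
  fixes u f f1 f2 f3 :: "real \<Rightarrow> real"
  assumes ab: "a \<le> b"
    and cont: "continuous_on {a..b} u" "continuous_on {a..b} f"
      "continuous_on {a..b} f1" "continuous_on {a..b} f2"
    and der: "\<And>s. a < s \<Longrightarrow> s < b \<Longrightarrow> (u has_real_derivative f s) (at s)"
      "\<And>s. a < s \<Longrightarrow> s < b \<Longrightarrow> (f has_real_derivative f1 s) (at s)"
      "\<And>s. a < s \<Longrightarrow> s < b \<Longrightarrow> (f1 has_real_derivative f2 s) (at s)"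
      "\<And>s. a < s \<Longrightarrow> s < b \<Longrightarrow> (f2 has_real_derivative f3 s) (at s)"
    and bound: "\<And>s. a < s \<Longrightarrow> s < b \<Longrightarrow> \<bar>f3 s\<bar> \<le> M"
    and M: "0 \<le> M"
  shows "\<bar>f b - f a - f1 a * (b - a) - f2 a * (b - a)\<^sup>2 / 2\<bar> \<le> M * (b - a) ^ 3"
    and "\<bar>u b - u a - f a * (b - a) - f1 a * (b - a)\<^sup>2 / 2 - f2 a * (b - a) ^ 3 / 6\<bar> \<le> M * (b - a) ^ 4"
proof -
  define g1 where "g1 s = f1 s - f1 a - f2 a * (s - a)" for s
  define g where "g s = f s - f a - f1 a * (s - a) - f2 a * (s - a)\<^sup>2 / 2" for s
  define v where "v s = u s - u a - f a * (s - a) - f1 a * (s - a)\<^sup>2 / 2 - f2 a * (s - a) ^ 3 / 6" for s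
  have c: "continuous_on {a..b} g1" "continuous_on {a..b} g" "continuous_on {a..b} v"
    unfolding g1_def g_def v_def by (intro continuous_intros cont; simp)+
  have d1: "(g1 has_real_derivative f2 s - f2 a) (at s)" if "a < s" "s < b" for s
    unfolding g1_def by (rule derivative_eq_intros der that refl | simp)+
  have d2: "(g has_real_derivative g1 s) (at s)" if "a < s" "s < b" for s
    unfolding g_def g1_def by (rule derivative_eq_intros der that refl | simp)+
  have d3: "(v has_real_derivative g s) (at s)" if "a < s" "s < b" for s
    unfolding g_def v_def by (rule derivative_eq_intros der that refl | simp add: power2_eq_square)+
  have b0: "\<bar>f2 s - f2 a\<bar> \<le> M * (s - a) ^ Suc 0" if "a \<le> s" "s \<le> b" for s
    by (rule abs_increment_le[OF cont(4) that der(4)]) (use bound M in auto)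
  have b1: "\<bar>g1 s\<bar> \<le> M * (s - a) ^ 2" if "a \<le> s" "s \<le> b" for s
    using abs_increment_le[OF c(1) that d1, where k = 1 and C = M] b0 M
    by (simp add: g1_def power2_eq_square)
  have b2: "\<bar>g s\<bar> \<le> M * (s - a) ^ 3" if "a \<le> s" "s \<le> b" for s
    using abs_increment_le[OF c(2) that d2, where k = 2 and C = M] b1 M
    by (simp add: g_def eval_nat_numeral)
  have b3: "\<bar>v s\<bar> \<le> M * (s - a) ^ 4" if "a \<le> s" "s \<le> b" for s
    using abs_increment_le[OF c(3) that d3, where k = 3 and C = M] b2 M
    by (simp add: v_def eval_nat_numeral)
  show "\<bar>f b - f a - f1 a * (b - a) - f2 a * (b - a)\<^sup>2 / 2\<bar> \<le> M * (b - a) ^ 3"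
    "\<bar>u b - u a - f a * (b - a) - f1 a * (b - a)\<^sup>2 / 2 - f2 a * (b - a) ^ 3 / 6\<bar> \<le> M * (b - a) ^ 4"
    using b2[of b] b3[of b] ab by (simp_all add: g_def v_def)
qed

section \<open>Closed forms and Lipschitz bounds for the scaled specular mean\<close>

lemma sqrt_sum_squares_scaled:
  fixes \<sigma> a :: real
  assumes "0 < \<sigma>"
  shows "sqrt (1 + (a / \<sigma>)\<^sup>2) = sqrt (\<sigma>\<^sup>2 + a\<^sup>2) / \<sigma>"
proof -
  have "1 + (a / \<sigma>)\<^sup>2 = (\<sigma>\<^sup>2 + a\<^sup>2) / \<sigma>\<^sup>2"
    using assms by (simp add: field_simps)
  then show ?thesis
    using assms by (simp add: real_sqrt_divide)
qed

text \<open>Clearing the factor \<open>\<sigma>\<close> exhibits the mean as a weighted average in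
  which the weight of each slope is proportional to the root belonging to the other one.\<close>

lemma spec_mean_scaled_eq:
  assumes "0 < \<sigma>"
  shows "spec_mean_scaled \<sigma> a b =
    (a * sqrt (\<sigma>\<^sup>2 + b\<^sup>2) + b * sqrt (\<sigma>\<^sup>2 + a\<^sup>2)) / (sqrt (\<sigma>\<^sup>2 + a\<^sup>2) + sqrt (\<sigma>\<^sup>2 + b\<^sup>2))"
proof -
  define A B where "A = sqrt (\<sigma>\<^sup>2 + a\<^sup>2)" and "B = sqrt (\<sigma>\<^sup>2 + b\<^sup>2)"
  have pos: "0 < A" "0 < B"
    using assms by (simp_all add: A_def B_def add_pos_nonneg)
  have "a / A + b / B = (a * B + b * A) / (A * B)" "\<sigma> / A + \<sigma> / B = \<sigma> * (A + B) / (A * B)"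
    using pos by (simp_all add: field_simps)
  then show ?thesis
    using assms pos
    by (simp add: spec_mean_scaled_def spec_mean_def sqrt_sum_squares_scaled flip: A_def B_def)
qed

text \<open>Field arithmetic for the next lemma, with \<open>x\<close> the numerator a B + b A,
  \<open>S\<close> = A + B, \<open>y\<close> = a + b and \<open>z\<close> = (a - b)^2.\<close>

lemma spec_mean_quotient_aux:
  fixes S x y z :: real
  assumes "S \<noteq> 0" "2 * x * S = y * S\<^sup>2 - z * y"
  shows "x / S = y / 2 - z * (y / 2) / S\<^sup>2"
proof -
  have "y / 2 - z * (y / 2) / S\<^sup>2 = (y * S\<^sup>2 - z * y) / (2 * S\<^sup>2)"
    using assms(1) by (simp add: field_simps)
  also have "\<dots> = 2 * x * S / (2 * S\<^sup>2)"
    by (simp only: assms(2))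
  also have "\<dots> = x / S"
    using assms(1) by (simp add: power2_eq_square)
  finally show ?thesis by simp
qed

text \<open>Twice the numerator is (a + b)(A + B) - (a - b)(A - B). Multiplying by A + B and using
  A^2 - B^2 = a^2 - b^2 removes the difference of the roots.\<close>

lemma spec_mean_scaled_eq_mean_minus:
  assumes "0 < \<sigma>"
  shows "spec_mean_scaled \<sigma> a b =
    (a + b) / 2 - (a - b)\<^sup>2 * ((a + b) / 2) / (sqrt (\<sigma>\<^sup>2 + a\<^sup>2) + sqrt (\<sigma>\<^sup>2 + b\<^sup>2))\<^sup>2"
proof -
  define A B where "A = sqrt (\<sigma>\<^sup>2 + a\<^sup>2)" and "B = sqrt (\<sigma>\<^sup>2 + b\<^sup>2)"
  have pos: "0 < A + B"
    using assms by (simp add: A_def B_def add_pos_nonneg)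
  have "A\<^sup>2 = \<sigma>\<^sup>2 + a\<^sup>2" "B\<^sup>2 = \<sigma>\<^sup>2 + b\<^sup>2"
    by (simp_all add: A_def B_def)
  then have "(A - B) * (A + B) = (a - b) * (a + b)"
    by (simp add: algebra_simps power2_eq_square)
  then have "2 * (a * B + b * A) * (A + B) = (a + b) * (A + B)\<^sup>2 - (a - b)\<^sup>2 * (a + b)"
    by algebra
  then have "(a * B + b * A) / (A + B) = (a + b) / 2 - (a - b)\<^sup>2 * ((a + b) / 2) / (A + B)\<^sup>2"
    using spec_mean_quotient_aux[of "A + B"] pos by simp
  then show ?thesis
    using assms by (simp add: spec_mean_scaled_eq A_def B_def)
qed

text \<open>Reverse triangle inequality for the Euclidean norm of the plane.\<close>

lemma abs_sqrt_sum_squares_diff_le: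
  fixes a b c d :: real
  shows "\<bar>sqrt (a\<^sup>2 + b\<^sup>2) - sqrt (c\<^sup>2 + d\<^sup>2)\<bar> \<le> \<bar>a - c\<bar> + \<bar>b - d\<bar>"
proof -
  have "\<bar>norm (a, b) - norm (c, d)\<bar> \<le> norm ((a, b) - (c, d))"
    by (rule norm_triangle_ineq3)
  also have "\<dots> \<le> \<bar>a - c\<bar> + \<bar>b - d\<bar>"
    using sqrt_sum_squares_le_sum_abs by (simp add: norm_Pair)
  finally show ?thesis by (simp add: norm_Pair)
qed

text \<open>The mean \<open>c\<close> of \<open>a\<close> and \<open>b\<close> satisfies \<open>(a - c) B + (b - c) A = 0\<close>; subtracting
  this relation for the two data sets isolates \<open>(A + B) (c - c')\<close>.\<close>
lemma spec_mean_scaled_Lipschitz: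
  fixes s M :: real
  assumes s: "0 < s" "s \<le> \<sigma>" "s \<le> \<sigma>'" and M: "\<bar>a'\<bar> \<le> M" "\<bar>b'\<bar> \<le> M"
  shows "\<bar>spec_mean_scaled \<sigma> a b - spec_mean_scaled \<sigma>' a' b'\<bar> \<le>
    (1 + 2 * M / s) * (\<bar>a - a'\<bar> + \<bar>b - b'\<bar> + \<bar>\<sigma> - \<sigma>'\<bar>)"
proof -
  define A B A' B' where "A = sqrt (\<sigma>\<^sup>2 + a\<^sup>2)" and "B = sqrt (\<sigma>\<^sup>2 + b\<^sup>2)"
    and "A' = sqrt (\<sigma>'\<^sup>2 + a'\<^sup>2)" and "B' = sqrt (\<sigma>'\<^sup>2 + b'\<^sup>2)"
  define c c' where "c = spec_mean_scaled \<sigma> a b" and "c' = spec_mean_scaled \<sigma>' a' b'"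
  have A: "s \<le> A" "s \<le> B" "s \<le> A'" "s \<le> B'"
    using s unfolding A_def B_def A'_def B'_def by (auto intro!: real_le_rsqrt power_mono add_increasing2)
  have c: "c = (a * B + b * A) / (A + B)" "c' = (a' * B' + b' * A') / (A' + B')"
    using s by (auto simp: c_def c'_def A_def B_def A'_def B'_def spec_mean_scaled_eq)
  have pos: "0 < A + B" "0 < A' + B'" using A s by auto
  \<comment> \<open>The averaging weights are at most 1, so \<open>c'\<close> lies within
    \<open>\<bar>a' - b'\<bar> \<le> 2 * M\<close> of both data.\<close>
  have "a' - c' = (a' - b') * (A' / (A' + B'))" "b' - c' = (b' - a') * (B' / (A' + B'))"
    using pos unfolding c by (simp_all add: field_simps)
  moreover have "\<bar>a' - b'\<bar> * (A' / (A' + B')) \<le> 2 * M * 1" "\<bar>b' - a'\<bar> * (B' / (A' + B')) \<le> 2 * M * 1"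
    using M pos A s by (intro mult_mono; simp)+
  ultimately have m: "\<bar>a' - c'\<bar> \<le> 2 * M" "\<bar>b' - c'\<bar> \<le> 2 * M"
    using A s by (simp_all add: abs_mult)
  have *: "\<bar>A - A'\<bar> \<le> \<bar>\<sigma> - \<sigma>'\<bar> + \<bar>a - a'\<bar>" "\<bar>B - B'\<bar> \<le> \<bar>\<sigma> - \<sigma>'\<bar> + \<bar>b - b'\<bar>"
    unfolding A_def B_def A'_def B'_def by (rule abs_sqrt_sum_squares_diff_le)+
  define E where "E = \<bar>a - a'\<bar> + \<bar>b - b'\<bar> + \<bar>\<sigma> - \<sigma>'\<bar>"
  have abs_add_four: "\<bar>p + q + r + s\<bar> \<le> \<bar>p\<bar> + \<bar>q\<bar> + \<bar>r\<bar> + \<bar>s\<bar>" for p q r s :: real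
    by linarith
  have "c' * (A' + B') = a' * B' + b' * A'" "c * (A + B) = a * B + b * A"
    using pos unfolding c by simp_all
  then have eq: "(A + B) * (c - c') =
      (a - a') * B + (b - b') * A + (a' - c') * (B - B') + (b' - c') * (A - A')"
    by algebra
  have "(A + B) * \<bar>c - c'\<bar> = \<bar>(A + B) * (c - c')\<bar>"
    using pos by (simp add: abs_mult)
  also have "\<dots> \<le> \<bar>a - a'\<bar> * B + \<bar>b - b'\<bar> * A + \<bar>a' - c'\<bar> * \<bar>B - B'\<bar> + \<bar>b' - c'\<bar> * \<bar>A - A'\<bar>"
    unfolding eq using A s by (intro order.trans[OF abs_add_four]) (simp add: abs_mult)
  also have "\<dots> \<le> E * B + E * A + 2 * M * E + 2 * M * E"
  proof -
    have "\<bar>a - a'\<bar> \<le> E" "\<bar>b - b'\<bar> \<le> E" "\<bar>A - A'\<bar> \<le> E" "\<bar>B - B'\<bar> \<le> E"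
      using * unfolding E_def by linarith+
    moreover have "0 \<le> A" "0 \<le> B" "0 \<le> M"
      using A s M by linarith+
    ultimately show ?thesis
      using m by (intro add_mono mult_mono) auto
  qed
  also have "\<dots> \<le> (A + B) * ((1 + 2 * M / s) * E)"
  proof -
    \<comment> \<open>Here 1/s enters: 4 M E equals 2 s (2 M E / s), and
      \<open>2 * s \<le> A + B\<close>.\<close>
    have "0 \<le> 2 * M * E / s" using M s by (auto simp: E_def)
    then have "2 * s * (2 * M * E / s) \<le> (A + B) * (2 * M * E / s)"
      using A by (intro mult_right_mono) auto
    then show ?thesis using s by (simp add: algebra_simps)
  qed
  finally show ?thesis
    using pos by (simp add: c_def c'_def E_def)
qed

section \<open>Convergence of implicit one-step methods\<close>

lemma grid_0 [simp]: "grid t0 h 0 = t0"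
  and grid_Suc: "grid t0 h (Suc n) = grid t0 h n + h"
  by (simp_all add: grid_def algebra_simps)

lemma num_steps_le:
  assumes "0 < h" "t0 \<le> T" "n \<le> num_steps t0 T h"
  shows "real n * h \<le> T - t0"
proof -
  have "real n \<le> real_of_int \<lfloor>(T - t0) / h\<rfloor>"
    using assms by (simp add: num_steps_def of_nat_le_iff nat_le_iff le_nat_iff)
  also have "\<dots> \<le> (T - t0) / h" by simp
  finally show ?thesis using assms(1) by (simp add: field_simps)
qed

lemma grid_mem:
  assumes "0 < h" "t0 \<le> T" "n \<le> num_steps t0 T h"
  shows "grid t0 h n \<in> {t0..T}"
  using num_steps_le[OF assms] assms(1) by (simp add: grid_def algebra_simps)

text \<open>Banach's fixed point theorem on the closed ball around \<open>c\<close>, with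
  contraction factor 1/2 from \<open>h * P \<le> 1/2\<close>.\<close>

lemma implicit_step_exists:
  fixes g :: "real \<Rightarrow> real"
  assumes h: "0 < h" "h * P \<le> 1/2"
    and Lip: "\<And>y z. \<bar>y - c\<bar> \<le> \<rho> \<Longrightarrow> \<bar>z - c\<bar> \<le> \<rho> \<Longrightarrow> \<bar>g y - g z\<bar> \<le> P * \<bar>y - z\<bar>"
    and bound: "\<And>y. \<bar>y - c\<bar> \<le> \<rho> \<Longrightarrow> \<bar>x + h * g y - c\<bar> \<le> \<rho>"
    and "0 \<le> \<rho>"
  shows "\<exists>y. \<bar>y - c\<bar> \<le> \<rho> \<and> y = x + h * g y"
proof -
  have "\<exists>!y\<in>cball c \<rho>. x + h * g y = y"
  proof (rule Banach_fix[where c = "1/2"])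
    show "dist (x + h * g y) (x + h * g z) \<le> 1/2 * dist y z"
      if "y \<in> cball c \<rho>" "z \<in> cball c \<rho>" for y z
    proof -
      have "dist (x + h * g y) (x + h * g z) = h * \<bar>g y - g z\<bar>"
        using h(1) by (simp add: dist_real_def abs_mult flip: right_diff_distrib)
      also have "\<dots> \<le> h * (P * \<bar>y - z\<bar>)"
        using h(1) that by (intro mult_left_mono Lip) (auto simp: dist_real_def abs_minus_commute)
      also have "\<dots> \<le> 1/2 * \<bar>y - z\<bar>"
        using mult_right_mono[OF h(2), of "\<bar>y - z\<bar>"] by (simp add: mult.assoc)
      finally show ?thesis by (simp add: dist_real_def)
    qed
    show "(\<lambda>y. x + h * g y) ` cball c \<rho> \<subseteq> cball c \<rho>"
      using bound by (auto simp: dist_real_def abs_minus_commute)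
  qed (use \<open>0 \<le> \<rho>\<close> in \<open>auto intro: compact_imp_complete\<close>)
  then obtain y where "y \<in> cball c \<rho>" "x + h * g y = y"
    by blast
  then show ?thesis
    by (intro exI[of _ y]) (simp add: dist_real_def abs_minus_commute)
qed

text \<open>Solves the implicit inequality for \<open>e'\<close>: with q = h P at most 1/2, (1 +
  q)/(1 - q) is at most 1 + 4 q and 1/(1 - q) is at most 2.\<close>

lemma one_step_error:
  fixes e e' h P D :: real
  assumes "0 < h" "0 \<le> P" "h * P \<le> 1/2" "0 \<le> e" "0 \<le> D"
    and "e' \<le> e + h * P * (e + e') + D"
  shows "e' \<le> (1 + 4 * P * h) * e + 2 * D"
proof -
  define q where "q = h * P"
  have q: "0 \<le> q" "q \<le> 1/2" using assms by (auto simp: q_def)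
  have "(1 - q) * e' \<le> (1 + q) * e + D"
    using assms(6) by (simp add: q_def algebra_simps)
  also have "\<dots> \<le> (1 - q) * ((1 + 4 * q) * e + 2 * D)"
  proof -
    have "q * q \<le> q * (1/2)" using q by (intro mult_left_mono) auto
    then have "(1 + q) * e \<le> ((1 - q) * (1 + 4 * q)) * e"
      using \<open>0 \<le> e\<close> by (intro mult_right_mono) (auto simp: algebra_simps)
    moreover have "1 * D \<le> ((1 - q) * 2) * D"
      using q \<open>0 \<le> D\<close> by (intro mult_right_mono) auto
    ultimately show ?thesis by (simp add: algebra_simps)
  qed
  finally have "e' \<le> (1 + 4 * q) * e + 2 * D"
    using q by (simp add: mult_le_cancel_left_pos)
  then show ?thesis
    by (simp add: q_def mult_ac)
qed

text \<open>Lipschitz continuity in the tube and a local error of order p + 1 give global order p.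
  The error bound is carried along while the sequence is being built, because it keeps each iterate
  within \<open>\<rho> / 2\<close> of the solution and so makes the next implicit equation solvable
  in the tube.\<close>

lemma implicit_one_step_convergence:
  fixes u :: "real \<Rightarrow> real" and \<phi> :: "real \<Rightarrow> real \<Rightarrow> real \<Rightarrow> real \<Rightarrow> real"
  assumes "t0 < T" "0 < \<rho>" "0 < p" "0 < h0"
    and Lip: "\<And>h t x x' y y'. 0 < h \<Longrightarrow> (t, x) \<in> tube t0 T \<rho> u \<Longrightarrow> (t, x') \<in> tube t0 T \<rho> u \<Longrightarrow>
      (t + h, y) \<in> tube t0 T \<rho> u \<Longrightarrow> (t + h, y') \<in> tube t0 T \<rho> u \<Longrightarrow>
      \<bar>\<phi> h t x y - \<phi> h t x' y'\<bar> \<le> P * (\<bar>x - x'\<bar> + \<bar>y - y'\<bar>)"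
    and bound: "\<And>h t x y. 0 < h \<Longrightarrow> (t, x) \<in> tube t0 T \<rho> u \<Longrightarrow> (t + h, y) \<in> tube t0 T \<rho> u \<Longrightarrow>
      \<bar>\<phi> h t x y\<bar> \<le> M"
    and u_Lip: "\<And>h t. 0 < h \<Longrightarrow> t0 \<le> t \<Longrightarrow> t + h \<le> T \<Longrightarrow> \<bar>u (t + h) - u t\<bar> \<le> M * h"
    and consistent: "\<And>h t. 0 < h \<Longrightarrow> h \<le> h0 \<Longrightarrow> t0 \<le> t \<Longrightarrow> t + h \<le> T \<Longrightarrow>
      \<bar>u (t + h) - u t - h * \<phi> h t (u t) (u (t + h))\<bar> \<le> D * h ^ Suc p"
    and nonneg: "0 \<le> P" "0 \<le> M" "0 \<le> D"
  defines "adm \<equiv> \<lambda>h w. w 0 = u t0 \<and>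
      (\<forall>n<num_steps t0 T h. w (Suc n) = w n + h * \<phi> h (grid t0 h n) (w n) (w (Suc n))) \<and>
      (\<forall>n\<le>num_steps t0 T h. (grid t0 h n, w n) \<in> tube t0 T \<rho> u)"
  shows "\<exists>H>0. \<exists>C>0. \<forall>h\<in>{0<..H}. \<exists>w :: nat \<Rightarrow> real. adm h w \<and>
      (\<forall>v. adm h v \<longrightarrow> (\<forall>n\<le>num_steps t0 T h. v n = w n)) \<and>
      (\<forall>n\<le>num_steps t0 T h. \<bar>u (grid t0 h n) - w n\<bar> \<le> C * h ^ p)"
proof -
  \<comment> \<open>The summand 1 keeps \<open>C\<close> positive when \<open>D\<close> is 0, as
    \<open>H\<close> divides by it.\<close>
  define C where "C = 2 * D * (T - t0) * exp (4 * P * (T - t0)) + 1"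
  \<comment> \<open>In turn: consistency holds, h^p is at most h, the implicit step contracts, the
    global error stays below \<open>\<rho> / 2\<close>, and one step moves solution and iterate by
    at most \<open>\<rho> / 4\<close> each.\<close>
  define H where "H = Min {h0, 1, 1 / (2 * (P + 1)), \<rho> / (2 * C), \<rho> / (4 * (M + 1))}"
  have "0 < C"
    using assms(1) nonneg by (auto simp: C_def intro!: add_nonneg_pos)
  then have "0 < H"
    using assms(2,4) nonneg by (auto simp: H_def)
  have "\<exists>w. adm h w \<and>
      (\<forall>v. adm h v \<longrightarrow> (\<forall>n\<le>num_steps t0 T h. v n = w n)) \<and>
      (\<forall>n\<le>num_steps t0 T h. \<bar>u (grid t0 h n) - w n\<bar> \<le> C * h ^ p)" if "0 < h" "h \<le> H" for h
  proof -
    let ?N = "num_steps t0 T h"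
    let ?t = "grid t0 h"
    have "h \<le> h0" "h \<le> 1" "h \<le> 1 / (2 * (P + 1))" "h \<le> \<rho> / (2 * C)" "h \<le> \<rho> / (4 * (M + 1))"
      using \<open>h \<le> H\<close> by (auto simp: H_def)
    then have hP: "h * P \<le> 1/2" and hC: "C * h \<le> \<rho> / 2" and hM: "h * M \<le> \<rho> / 4"
      using \<open>0 < h\<close> \<open>0 < C\<close> nonneg by (auto simp: field_simps)
    \<comment> \<open>Explicit majorant of the error recursion in \<open>one_step_error\<close>, the
      Gronwall bound; \<open>num_steps_le\<close> makes it uniform in \<open>n\<close>.\<close>
    define B where "B n = exp (4 * P * (real n * h)) * (2 * D * (real n * h) * h ^ p)" for n
    have B_Suc: "(1 + 4 * P * h) * B n + 2 * (D * h ^ Suc p) \<le> B (Suc n)" for n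
    proof -
      let ?E = "exp (4 * P * (real n * h))" and ?E' = "exp (4 * P * (real (Suc n) * h))"
      have "?E' = exp (4 * P * h) * ?E"
        by (simp add: algebra_simps flip: exp_add)
      moreover have "1 + 4 * P * h \<le> exp (4 * P * h)"
        by (rule exp_ge_add_one_self)
      ultimately have "(1 + 4 * P * h) * ?E \<le> ?E'"
        by simp
      then have "(1 + 4 * P * h) * ?E * (2 * D * (real n * h) * h ^ p) \<le> ?E' * (2 * D * (real n * h) * h ^ p)"
        using \<open>0 < h\<close> nonneg by (intro mult_right_mono) auto
      moreover have "1 * (2 * (D * h ^ Suc p)) \<le> ?E' * (2 * (D * h ^ Suc p))"
        using \<open>0 < h\<close> nonneg by (intro mult_right_mono) auto
      ultimately show ?thesis
        by (simp add: B_def algebra_simps)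
    qed
    have B_le: "B n \<le> C * h ^ p" if "n \<le> ?N" for n
    proof -
      have nh: "real n * h \<le> T - t0"
        using num_steps_le \<open>0 < h\<close> assms(1) that by simp
      have "B n \<le> exp (4 * P * (T - t0)) * (2 * D * (T - t0) * h ^ p)"
        unfolding B_def using nh \<open>0 < h\<close> nonneg assms(1)
        by (intro mult_mono mult_right_mono mult_left_mono) (auto intro!: mult_left_mono)
      also have "\<dots> \<le> C * h ^ p"
        using \<open>0 < h\<close> by (simp add: C_def algebra_simps)
      finally show ?thesis .
    qed
    have "h ^ p \<le> h"
      using power_decreasing[of 1 p h] \<open>0 < p\<close> \<open>0 < h\<close> \<open>h \<le> 1\<close> by simp
    then have "C * h ^ p \<le> C * h"
      using \<open>0 < C\<close> by simp
    then have B_\<rho>: "B n \<le> \<rho> / 2" if "n \<le> ?N" for n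
      using B_le[OF that] hC by linarith
    have t_mem: "t0 \<le> ?t n" "?t n \<le> T" if "n \<le> ?N" for n
      using grid_mem[of h t0 T n] \<open>0 < h\<close> assms(1) that by auto
    have step: "\<exists>y. ((?t (Suc n), y) \<in> tube t0 T \<rho> u \<and> \<bar>u (?t (Suc n)) - y\<bar> \<le> B (Suc n)) \<and>
        y = x + h * \<phi> h (?t n) x y"
      if n: "Suc n \<le> ?N" and x: "\<bar>u (?t n) - x\<bar> \<le> B n" for n x
    proof -
      let ?s = "?t n" and ?s' = "?t (Suc n)"
      have s: "?s' = ?s + h" "t0 \<le> ?s" "?s + h \<le> T"
        using t_mem[of n] t_mem[of "Suc n"] n by (auto simp: grid_Suc)
      have x': "\<bar>x - u ?s\<bar> \<le> \<rho> / 2"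
        using x B_\<rho>[of n] n by (simp add: abs_minus_commute)
      then have tx: "(?s, x) \<in> tube t0 T \<rho> u"
        using s \<open>0 < h\<close> \<open>0 < \<rho>\<close> by (auto simp: tube_def)
      have ty: "(?s + h, y) \<in> tube t0 T \<rho> u" if "\<bar>y - u ?s'\<bar> \<le> \<rho>" for y
        using that s \<open>0 < h\<close> by (auto simp: tube_def)
      have "\<exists>y. \<bar>y - u ?s'\<bar> \<le> \<rho> \<and> y = x + h * \<phi> h ?s x y"
      proof (rule implicit_step_exists[OF \<open>0 < h\<close> hP])
        show "\<bar>\<phi> h ?s x y - \<phi> h ?s x z\<bar> \<le> P * \<bar>y - z\<bar>"
          if "\<bar>y - u ?s'\<bar> \<le> \<rho>" "\<bar>z - u ?s'\<bar> \<le> \<rho>" for y z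
          using Lip[OF \<open>0 < h\<close> tx tx ty[OF that(1)] ty[OF that(2)]] by simp
        \<comment> \<open>The radius is spent as \<open>\<rho> / 2\<close> for the present error,
          \<open>\<rho> / 4\<close> for the increment and \<open>\<rho> / 4\<close> for the motion
          of the solution.\<close>
        show "\<bar>x + h * \<phi> h ?s x y - u ?s'\<bar> \<le> \<rho>" if "\<bar>y - u ?s'\<bar> \<le> \<rho>" for y
        proof -
          have "\<bar>h * \<phi> h ?s x y\<bar> \<le> h * M"
            using mult_left_mono[OF bound[OF \<open>0 < h\<close> tx ty[OF that]], of h] \<open>0 < h\<close>
            by (simp add: abs_mult)
          then show ?thesis
            using hM x' u_Lip[OF \<open>0 < h\<close> s(2,3)] \<open>0 < \<rho>\<close>
            unfolding s(1) mult.commute[of M h] by linarith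
        qed
      qed (use \<open>0 < \<rho>\<close> in simp)
      then obtain y where y: "\<bar>y - u ?s'\<bar> \<le> \<rho>" "y = x + h * \<phi> h ?s x y"
        by blast
      define e e' where "e = \<bar>u ?s - x\<bar>" and "e' = \<bar>u ?s' - y\<bar>"
      have tu: "(?s, u ?s) \<in> tube t0 T \<rho> u" "(?s + h, u ?s') \<in> tube t0 T \<rho> u"
        using s \<open>0 < h\<close> \<open>0 < \<rho>\<close> by (auto simp: tube_def)
      let ?d = "\<phi> h ?s (u ?s) (u ?s') - \<phi> h ?s x y"
      have "\<bar>h * ?d\<bar> \<le> h * (P * (e + e'))"
        using mult_left_mono[OF Lip[OF \<open>0 < h\<close> tu(1) tx tu(2) ty[OF y(1)]], of h] \<open>0 < h\<close>
        by (simp add: abs_mult e_def e'_def)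
      \<comment> \<open>New error = old error + perturbation of the increment + local
        defect.\<close>
      moreover have "u ?s' - y = (u ?s - x) + h * ?d +
          (u ?s' - u ?s - h * \<phi> h ?s (u ?s) (u ?s'))"
        by (subst y(2)) (simp add: algebra_simps)
      moreover have "\<bar>u ?s' - u ?s - h * \<phi> h ?s (u ?s) (u ?s')\<bar> \<le> D * h ^ Suc p"
        using consistent[OF \<open>0 < h\<close> \<open>h \<le> h0\<close> s(2,3)] by (simp add: s(1))
      ultimately have "e' \<le> e + h * P * (e + e') + D * h ^ Suc p"
        unfolding e_def e'_def by linarith
      then have "e' \<le> (1 + 4 * P * h) * e + 2 * (D * h ^ Suc p)"
        by (rule one_step_error[OF \<open>0 < h\<close> nonneg(1) hP, rotated -1])
          (use \<open>0 < h\<close> nonneg in \<open>auto simp: e_def\<close>)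
      also have "\<dots> \<le> (1 + 4 * P * h) * B n + 2 * (D * h ^ Suc p)"
        using x \<open>0 < h\<close> nonneg by (auto simp: e_def intro!: mult_left_mono)
      also have "\<dots> \<le> B (Suc n)"
        by (rule B_Suc)
      finally show ?thesis
        using y ty s(1) by (auto simp: e'_def)
    qed
    \<comment> \<open>Vacuous beyond the last step, so that dependent choice can produce a total
      sequence.\<close>
    define Q where "Q n x \<longleftrightarrow> (n \<le> ?N \<longrightarrow> (?t n, x) \<in> tube t0 T \<rho> u \<and> \<bar>u (?t n) - x\<bar> \<le> B n)" for n x
    have "\<exists>w. \<forall>n. Q n (w n) \<and> (Suc n \<le> ?N \<longrightarrow> w (Suc n) = w n + h * \<phi> h (?t n) (w n) (w (Suc n)))"
    proof (rule dependent_nat_choice)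
      show "\<exists>x. Q 0 x"
        using assms(1,2) by (intro exI[of _ "u t0"]) (simp add: Q_def B_def tube_def)
      show "\<exists>y. Q (Suc n) y \<and> (Suc n \<le> ?N \<longrightarrow> y = x + h * \<phi> h (?t n) x y)" if "Q n x" for x n
        using that step[of n x] by (cases "Suc n \<le> ?N") (auto simp: Q_def)
    qed
    then obtain w where w: "\<And>n. Q n (w n)"
      "\<And>n. Suc n \<le> ?N \<Longrightarrow> w (Suc n) = w n + h * \<phi> h (?t n) (w n) (w (Suc n))"
      by blast
    \<comment> \<open>\<open>B 0\<close> is 0, so the invariant at 0 already fixes the initial
      value.\<close>
    have "\<bar>u (?t 0) - w 0\<bar> \<le> B 0"
      using w(1)[of 0] by (simp add: Q_def)
    then have "w 0 = u t0"
      by (simp add: B_def)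
    then have "adm h w"
      using w by (auto simp: adm_def Q_def)
    \<comment> \<open>Two successors of the same value that both lie in the tube differ by at most
      half their difference, hence coincide; membership in the tube is all that is used about the
      size of \<open>v\<close>.\<close>
    moreover have "v n = w n" if v: "adm h v" and "n \<le> ?N" for v n
      using \<open>n \<le> ?N\<close>
    proof (induction n)
      case 0
      then show ?case using \<open>w 0 = u t0\<close> v by (simp add: adm_def)
    next
      case (Suc n)
      then have eq: "v n = w n" and n: "n < ?N" by auto
      have tb: "(?t n, w n) \<in> tube t0 T \<rho> u" "(?t n + h, w (Suc n)) \<in> tube t0 T \<rho> u"
        "(?t n + h, v (Suc n)) \<in> tube t0 T \<rho> u"
        using \<open>adm h w\<close> v Suc.prems by (auto simp: adm_def simp flip: grid_Suc)
      have "v (Suc n) = w n + h * \<phi> h (?t n) (w n) (v (Suc n))"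
        using v n eq by (auto simp: adm_def)
      moreover have "w (Suc n) = w n + h * \<phi> h (?t n) (w n) (w (Suc n))"
        using w(2) n by simp
      ultimately have "v (Suc n) - w (Suc n) =
          h * (\<phi> h (?t n) (w n) (v (Suc n)) - \<phi> h (?t n) (w n) (w (Suc n)))"
        by (simp add: right_diff_distrib)
      then have "\<bar>v (Suc n) - w (Suc n)\<bar> =
          h * \<bar>\<phi> h (?t n) (w n) (v (Suc n)) - \<phi> h (?t n) (w n) (w (Suc n))\<bar>"
        using \<open>0 < h\<close> by (simp add: abs_mult)
      also have "\<dots> \<le> h * (P * \<bar>v (Suc n) - w (Suc n)\<bar>)"
        using Lip[OF \<open>0 < h\<close> tb(1,1,3,2)] \<open>0 < h\<close> by (intro mult_left_mono) auto
      also have "\<dots> \<le> 1/2 * \<bar>v (Suc n) - w (Suc n)\<bar>"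
        using mult_right_mono[OF hP, of "\<bar>v (Suc n) - w (Suc n)\<bar>"] by (simp add: mult.assoc)
      finally show ?case by simp
    qed
    moreover have "\<bar>u (?t n) - w n\<bar> \<le> C * h ^ p" if "n \<le> ?N" for n
      using w(1)[of n] B_le[OF that] that by (simp add: Q_def)
    ultimately show ?thesis by blast
  qed
  then show ?thesis
    using \<open>0 < H\<close> \<open>0 < C\<close> by (intro exI[of _ H] conjI exI[of _ C] ballI) auto
qed

section \<open>Local error of the optimally scaled mean\<close>

text \<open>\<open>ua\<close>, \<open>ub\<close> and \<open>f0\<close>, \<open>fb\<close> stand for
  the solution and its slope at the two ends, \<open>f1\<close> and \<open>f2\<close> for the
  slope's derivatives at the left end. The trapezoidal defect f2 h^3 / 12 meets the leading part f0
  f1^2 h^3 / (4 (\<open>\<sigma>\<close>^2 + f0^2)) of the correction, and \<open>opt\<close> says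
  that these are equal. What remains is of order h^4.\<close>

lemma spec_mean_scaled_residual:
  fixes s M h \<sigma> ua ub f0 fb f1 f2 :: real
  assumes s: "0 < s" "s \<le> \<sigma>" and h: "0 < h" "h \<le> 1"
    and M: "\<bar>f0\<bar> \<le> M" "\<bar>f1\<bar> \<le> M" "\<bar>f2\<bar> \<le> M"
    and opt: "(\<sigma>\<^sup>2 + f0\<^sup>2) * f2 = 3 * f0 * f1\<^sup>2"
    and f: "\<bar>fb - f0 - f1 * h - f2 * h\<^sup>2 / 2\<bar> \<le> M * h ^ 3"
    and u: "\<bar>ub - ua - f0 * h - f1 * h\<^sup>2 / 2 - f2 * h ^ 3 / 6\<bar> \<le> M * h ^ 4"
  shows "\<bar>ub - ua - h * spec_mean_scaled \<sigma> fb f0\<bar>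
    \<le> (2 * M + 6 * M ^ 3 / s\<^sup>2 + 31 * M ^ 4 / s ^ 3) * h ^ 4"
proof -
  define A B where "A = sqrt (\<sigma>\<^sup>2 + fb\<^sup>2)" and "B = sqrt (\<sigma>\<^sup>2 + f0\<^sup>2)"
  define d m where "d = fb - f0" and "m = (fb + f0) / 2"
  define r where "r = fb - f0 - f1 * h - f2 * h\<^sup>2 / 2"
  \<comment> \<open>\<open>q\<close> is the factor in the quadratic correction and \<open>q0\<close>
    its value when both slopes equal \<open>f0\<close>.\<close>
  define q q0 where "q = 1 / (A + B)\<^sup>2" and "q0 = 1 / (4 * B\<^sup>2)"
  have "0 \<le> M" using M by linarith
  have hpow: "h\<^sup>2 \<le> h" "h ^ 3 \<le> h\<^sup>2"
    using h power_decreasing[of 1 2 h] power_decreasing[of 2 3 h] by auto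
  have Mh: "M * h\<^sup>2 \<le> M * h" "M * h ^ 3 \<le> M * h\<^sup>2" "M * h \<le> M"
    using hpow h \<open>0 \<le> M\<close> by (auto intro!: mult_left_mono simp: mult_left_le)
  have "s \<le> sqrt (\<sigma>\<^sup>2)"
    using s by simp
  then have AB: "s \<le> A" "s \<le> B"
    unfolding A_def B_def by (auto intro: order.trans)
  have fh: "\<bar>f1 * h\<bar> \<le> M * h" "\<bar>f2 * h\<^sup>2\<bar> \<le> M * h\<^sup>2"
    using M h by (auto simp: abs_mult intro!: mult_right_mono)
  have d1: "\<bar>d - f1 * h\<bar> \<le> 2 * M * h\<^sup>2"
    using f fh Mh unfolding d_def by linarith
  then have d: "\<bar>d\<bar> \<le> 3 * M * h"
    using fh Mh by linarith
  moreover have "m - f0 = d / 2"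
    by (simp add: m_def d_def field_simps)
  ultimately have m: "\<bar>m - f0\<bar> \<le> 3 * M * h / 2"
    by linarith
  then have m': "\<bar>m\<bar> \<le> 3 * M"
    using Mh M by linarith
  have "\<bar>d\<bar>\<^sup>2 \<le> (3 * M * h)\<^sup>2"
    using d by (intro power_mono) auto
  then have dd: "d\<^sup>2 \<le> 9 * M\<^sup>2 * h\<^sup>2"
    by (simp add: power_mult_distrib)
  have pos: "0 < A" "0 < B" using AB s by linarith+
  have "4 * s\<^sup>2 \<le> 4 * B\<^sup>2"
    using AB s by (intro mult_left_mono power_mono) auto
  then have q0: "0 \<le> q0" "q0 \<le> 1 / (4 * s\<^sup>2)"
    using s by (auto simp: q0_def intro!: divide_left_mono mult_pos_pos)
  \<comment> \<open>The factor B - A is extracted because it is at most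
    \<open>\<bar>d\<bar>\<close>, hence of order h.\<close>
  have "q - q0 = (B - A) * (A + 3 * B) / (4 * B\<^sup>2 * (A + B)\<^sup>2)"
  proof -
    have "1 / X - 1 / Y = (Y - X) / (Y * X)" if "X \<noteq> 0" "Y \<noteq> 0" for X Y :: real
      using that by (simp add: field_simps)
    from this[of "(A + B)\<^sup>2" "4 * B\<^sup>2"]
    have "q - q0 = (4 * B\<^sup>2 - (A + B)\<^sup>2) / (4 * B\<^sup>2 * (A + B)\<^sup>2)"
      using pos by (simp add: q_def q0_def)
    moreover have "4 * B\<^sup>2 - (A + B)\<^sup>2 = (B - A) * (A + 3 * B)"
      by (simp add: algebra_simps power2_eq_square)
    ultimately show ?thesis by simp
  qed
  then have "\<bar>q - q0\<bar> = \<bar>B - A\<bar> * ((A + 3 * B) / (4 * B\<^sup>2 * (A + B)\<^sup>2))"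
    using pos by (simp add: abs_mult)
  also have "\<dots> \<le> \<bar>d\<bar> * (3 / (8 * s ^ 3))"
  proof (rule mult_mono)
    show "\<bar>B - A\<bar> \<le> \<bar>d\<bar>"
      using abs_sqrt_sum_squares_diff_le[of \<sigma> f0 \<sigma> fb]
      by (simp add: A_def B_def d_def abs_minus_commute)
    have "(A + 3 * B) / (4 * B\<^sup>2 * (A + B)\<^sup>2) \<le> 3 * (A + B) / (4 * B\<^sup>2 * (A + B)\<^sup>2)"
      using pos by (intro divide_right_mono) auto
    also have "\<dots> = 3 / (4 * B\<^sup>2 * (A + B))"
      using pos nonzero_mult_divide_mult_cancel_right[of "A + B" 3 "4 * B\<^sup>2 * (A + B)"]
      by (simp only: power2_eq_square[of "A + B"] mult.assoc)
    also have "\<dots> \<le> 3 / (4 * s\<^sup>2 * (s + s))"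
      using AB s by (intro divide_left_mono mult_mono power_mono add_mono mult_pos_pos) auto
    also have "\<dots> = 3 / (8 * s ^ 3)"
      by (simp add: power2_eq_square power3_eq_cube)
    finally show "(A + 3 * B) / (4 * B\<^sup>2 * (A + B)\<^sup>2) \<le> 3 / (8 * s ^ 3)" .
  qed (use pos in auto)
  also have "\<dots> \<le> 3 * M * h * (3 / (8 * s ^ 3))"
    using d s by (intro mult_right_mono) auto
  finally have qq: "\<bar>q - q0\<bar> \<le> 9 / 8 * M * h / s ^ 3"
    by simp
  have "\<bar>d\<^sup>2 * m * (q - q0)\<bar> \<le> (9 * M\<^sup>2 * h\<^sup>2) * (3 * M) * (9 / 8 * M * h / s ^ 3)"
    unfolding abs_mult using dd m' qq h \<open>0 \<le> M\<close> by (intro mult_mono) auto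
  also have "\<dots> = 243 / 8 * (M ^ 4 * h ^ 3 / s ^ 3)"
    by (simp add: eval_nat_numeral)
  \<comment> \<open>31 rounds up 243/8 = 9 * 3 * 9/8.\<close>
  also have "\<dots> \<le> 31 * (M ^ 4 * h ^ 3 / s ^ 3)"
    using s h \<open>0 \<le> M\<close> by (intro mult_right_mono) auto
  finally have b1: "\<bar>d\<^sup>2 * m * (q - q0)\<bar> \<le> 31 * (M ^ 4 * h ^ 3 / s ^ 3)" .
  have "\<bar>d\<^sup>2 * (m - f0)\<bar> \<le> (9 * M\<^sup>2 * h\<^sup>2) * (3 * M * h / 2)"
    unfolding abs_mult using dd m h \<open>0 \<le> M\<close> by (intro mult_mono) auto
  moreover have "\<bar>f0 * ((d - f1 * h) * (d + f1 * h))\<bar> \<le> M * ((2 * M * h\<^sup>2) * (4 * M * h))"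
    unfolding abs_mult using M d d1 fh h \<open>0 \<le> M\<close> by (intro mult_mono) auto
  ultimately have "\<bar>d\<^sup>2 * (m - f0) + f0 * ((d - f1 * h) * (d + f1 * h))\<bar> \<le>
      (9 * M\<^sup>2 * h\<^sup>2) * (3 * M * h / 2) + M * ((2 * M * h\<^sup>2) * (4 * M * h))"
    by linarith
  also have "\<dots> = 43 / 2 * (M ^ 3 * h ^ 3)"
    by (simp add: eval_nat_numeral)
  \<comment> \<open>24 rounds up 43/2 = 27/2 + 8 and becomes 6 after the factor 1/4 from
    \<open>q0\<close>.\<close>
  also have "\<dots> \<le> 24 * (M ^ 3 * h ^ 3)"
    using h \<open>0 \<le> M\<close> by (intro mult_right_mono) auto
  finally have "\<bar>q0 * (d\<^sup>2 * (m - f0) + f0 * ((d - f1 * h) * (d + f1 * h)))\<bar> \<le>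
      1 / (4 * s\<^sup>2) * (24 * (M ^ 3 * h ^ 3))"
    unfolding abs_mult using q0 by (intro mult_mono) auto
  then have b2: "\<bar>q0 * (d\<^sup>2 * (m - f0) + f0 * ((d - f1 * h) * (d + f1 * h)))\<bar> \<le>
      6 * (M ^ 3 * h ^ 3 / s\<^sup>2)"
    by simp
  have "B\<^sup>2 * f2 = 3 * f0 * f1\<^sup>2"
    using opt by (simp add: B_def)
  then have f2: "f2 = 12 * (f0 * f1\<^sup>2 * q0)"
    using pos by (simp add: q0_def field_simps)
  \<comment> \<open>After substituting for \<open>f2\<close>, \<open>q\<close> is replaced by
    \<open>q0\<close>, then \<open>m\<close> by \<open>f0\<close>, then \<open>d\<close> by f1 h;
    each replacement costs one power of h.\<close>
  have "d\<^sup>2 * m * q - f2 * h\<^sup>2 / 12 =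
      d\<^sup>2 * m * (q - q0) + q0 * (d\<^sup>2 * (m - f0) + f0 * ((d - f1 * h) * (d + f1 * h)))"
    unfolding f2 by (simp add: algebra_simps power2_eq_square)
  then have br: "\<bar>d\<^sup>2 * m * q - f2 * h\<^sup>2 / 12\<bar> \<le> 31 * (M ^ 4 * h ^ 3 / s ^ 3) + 6 * (M ^ 3 * h ^ 3 / s\<^sup>2)"
    using b1 b2 by linarith
  have spec: "spec_mean_scaled \<sigma> fb f0 = m - d\<^sup>2 * m * q"
    using s by (simp add: spec_mean_scaled_eq_mean_minus m_def d_def q_def A_def B_def)
  \<comment> \<open>Expanding h m leaves f2 h^3 (1/6 - 1/4) = - f2 h^3 / 12, which is grouped with
    the correction.\<close>
  have "ub - ua - h * spec_mean_scaled \<sigma> fb f0 =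
      (ub - ua - f0 * h - f1 * h\<^sup>2 / 2 - f2 * h ^ 3 / 6) - h * r / 2 + h * (d\<^sup>2 * m * q - f2 * h\<^sup>2 / 12)"
    unfolding spec r_def m_def by (simp add: field_simps power2_eq_square power3_eq_cube)
  moreover have "\<bar>h * r\<bar> \<le> h * (M * h ^ 3)"
    using f h by (simp add: abs_mult r_def)
  moreover have "\<bar>h * (d\<^sup>2 * m * q - f2 * h\<^sup>2 / 12)\<bar> \<le>
      h * (31 * (M ^ 4 * h ^ 3 / s ^ 3) + 6 * (M ^ 3 * h ^ 3 / s\<^sup>2))"
    using br h by (simp add: abs_mult)
  moreover have "0 \<le> h * (M * h ^ 3)"
    using h \<open>0 \<le> M\<close> by simp
  moreover have "M * h ^ 4 = h * (M * h ^ 3)"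
    by (simp add: eval_nat_numeral)
  ultimately have "\<bar>ub - ua - h * spec_mean_scaled \<sigma> fb f0\<bar> \<le>
      2 * (h * (M * h ^ 3)) + h * (31 * (M ^ 4 * h ^ 3 / s ^ 3) + 6 * (M ^ 3 * h ^ 3 / s\<^sup>2))"
    using u by linarith
  also have "\<dots> = (2 * M + 6 * M ^ 3 / s\<^sup>2 + 31 * M ^ 4 / s ^ 3) * h ^ 4"
    by (simp add: algebra_simps eval_nat_numeral)
  finally show ?thesis .
qed

section \<open>Positivity and smoothness of the optimal scale\<close>

lemma opt_scale_radicand_pos:
  assumes "0 < F p * Lie F (Lie F F) p" "F p * Lie F (Lie F F) p < 3 * (Lie F F p)\<^sup>2"
  shows "0 < 3 * F p * (Lie F F p)\<^sup>2 / Lie F (Lie F F) p - (F p)\<^sup>2"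
proof -
  have nz: "F p \<noteq> 0" "Lie F (Lie F F) p \<noteq> 0"
    using assms(1) by auto
  have "1 < 3 * (Lie F F p)\<^sup>2 / (F p * Lie F (Lie F F) p)"
    using assms by simp
  then have "(F p)\<^sup>2 * 1 < (F p)\<^sup>2 * (3 * (Lie F F p)\<^sup>2 / (F p * Lie F (Lie F F) p))"
    using nz by (intro mult_strict_left_mono) auto
  also have "\<dots> = 3 * F p * (Lie F F p)\<^sup>2 / Lie F (Lie F F) p"
    using nz by (simp add: field_simps power2_eq_square)
  finally show ?thesis by simp
qed

text \<open>The cancellation condition \<open>opt\<close> of
  \<open>spec_mean_scaled_residual\<close>; positivity of the radicand allows the root to be squared
  away.\<close>

lemma opt_scale_identity:
  assumes "0 < F p * Lie F (Lie F F) p" "F p * Lie F (Lie F F) p < 3 * (Lie F F p)\<^sup>2"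
  shows "((opt_scale F p)\<^sup>2 + (F p)\<^sup>2) * Lie F (Lie F F) p = 3 * F p * (Lie F F p)\<^sup>2"
  using opt_scale_radicand_pos[OF assms] assms(1) by (auto simp: opt_scale_def)

text \<open>The x-derivative of \<open>opt_scale F\<close>, written out by the chain and quotient
  rules so that its continuity on the tube can be read off from the factors.\<close>

definition opt_scale_dx :: "(real \<times> real \<Rightarrow> real) \<Rightarrow> real \<times> real \<Rightarrow> real" where
  "opt_scale_dx F p = inverse (opt_scale F p) / 2 *
     ((3 * (partial_x F p * (Lie F F p)\<^sup>2 + 2 * Lie F F p * partial_x (Lie F F) p * F p) * Lie F (Lie F F) p
        - 3 * F p * (Lie F F p)\<^sup>2 * partial_x (Lie F (Lie F F)) p) / (Lie F (Lie F F) p)\<^sup>2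
      - 2 * F p * partial_x F p)"

text \<open>\<open>Lie F (Lie F F)\<close> contains second derivatives of \<open>F\<close>;
  differentiating it once more uses up the C^3 regularity.\<close>

lemma opt_scale_has_derivative_x:
  assumes "open \<Omega>" "C_on 3 \<Omega> F" "(t, x) \<in> \<Omega>"
    and "0 < F (t, x) * Lie F (Lie F F) (t, x)"
    and "F (t, x) * Lie F (Lie F F) (t, x) < 3 * (Lie F F (t, x))\<^sup>2"
  shows "((\<lambda>y. opt_scale F (t, y)) has_real_derivative opt_scale_dx F (t, x)) (at x)"
proof -
  have C3: "C_on (Suc 2) \<Omega> F" using assms(2) by (simp add: numeral_3_eq_3)
  have C2: "C_on (Suc 1) \<Omega> (Lie F F)"
    using C_on_Lie[OF assms(1) C_on_SucD[OF C3] C3] by (simp only: Suc_1)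
  have "C_on 1 \<Omega> F"
    using C_on_SucD[of 1] C_on_SucD[OF C3] by (simp only: Suc_1)
  then have C1: "C_on (Suc 0) \<Omega> (Lie F (Lie F F))"
    using C_on_Lie[OF assms(1) _ C2] by (simp only: One_nat_def)
  let ?L = "Lie F F" and ?K = "Lie F (Lie F F)"
  have nz: "?K (t, x) \<noteq> 0" using assms(4) by auto
  note d = C3[THEN C_on_partial_x, OF assms(3)] C2[THEN C_on_partial_x, OF assms(3)]
    C1[THEN C_on_partial_x, OF assms(3)]
  have "((\<lambda>y. 3 * F (t, y) * (?L (t, y))\<^sup>2 / ?K (t, y) - (F (t, y))\<^sup>2) has_real_derivative
      (3 * (partial_x F (t, x) * (?L (t, x))\<^sup>2 + 2 * ?L (t, x) * partial_x ?L (t, x) * F (t, x)) * ?K (t, x)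
        - 3 * F (t, x) * (?L (t, x))\<^sup>2 * partial_x ?K (t, x)) / (?K (t, x))\<^sup>2
      - 2 * F (t, x) * partial_x F (t, x)) (at x)"
    by (rule derivative_eq_intros d refl nz)+ (simp add: power2_eq_square algebra_simps)
  from DERIV_chain2[OF DERIV_real_sqrt[OF opt_scale_radicand_pos[OF assms(4,5)]] this]
  show ?thesis
    by (simp only: opt_scale_def opt_scale_dx_def)
qed

section \<open>Compactness of the tube\<close>

text \<open>The tube is the image of a rectangle under the continuous shear (t, y) to (t, u(t) +
  y).\<close>

lemma compact_tube:
  assumes "continuous_on {t0..T} u"
  shows "compact (tube t0 T \<rho> u)"
proof -
  have "(t, x) \<in> (\<lambda>(t, y). (t, u t + y)) ` ({t0..T} \<times> {-\<rho>..\<rho>})" if "(t, x) \<in> tube t0 T \<rho> u" for t x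
    using that by (intro image_eqI[of _ _ "(t, x - u t)"]) (auto simp: tube_def abs_le_iff)
  then have "tube t0 T \<rho> u = (\<lambda>(t, y). (t, u t + y)) ` ({t0..T} \<times> {-\<rho>..\<rho>})"
    by (auto simp: tube_def)
  moreover have "continuous_on ({t0..T} \<times> {-\<rho>..\<rho>}) (\<lambda>(t, y). (t, u t + y))"
    unfolding case_prod_unfold
    by (intro continuous_intros continuous_on_compose2[OF assms]) auto
  ultimately show ?thesis
    by (simp add: compact_continuous_image compact_Times)
qed

lemma compact_abs_bound:
  fixes g :: "'a::topological_space \<Rightarrow> real"
  assumes "compact K" "continuous_on K g"
  obtains B where "0 \<le> B" "\<And>p. p \<in> K \<Longrightarrow> \<bar>g p\<bar> \<le> B"
proof -
  have "bounded (g ` K)"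
    using assms by (intro compact_imp_bounded compact_continuous_image)
  then obtain B where "0 < B" "\<And>y. y \<in> g ` K \<Longrightarrow> norm y \<le> B"
    unfolding bounded_pos by blast
  then show ?thesis
    using that[of B] by auto
qed

theorem theorem5p7:
  fixes \<Omega> :: "(real \<times> real) set"
    and F :: "real \<times> real \<Rightarrow> real"
    and u :: "real \<Rightarrow> real"
    and t0 T u0 \<rho> L :: real
  assumes "open \<Omega>"
    and "0 \<le> t0" and "t0 < T" and "(t0, u0) \<in> \<Omega>"
    and "C_on 3 \<Omega> F"
    and "unique_ivp_solution \<Omega> F t0 T u0 u"
    and "0 < \<rho>" and "0 \<le> L"
    and "tube t0 T \<rho> u \<subseteq> \<Omega>"
    and "\<And>t x y. (t, x) \<in> tube t0 T \<rho> u \<Longrightarrow> (t, y) \<in> tube t0 T \<rho> u \<Longrightarrow>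
           \<bar>F (t, x) - F (t, y)\<bar> \<le> L * \<bar>x - y\<bar>"
    and "\<And>p. p \<in> tube t0 T \<rho> u \<Longrightarrow>
           0 < F p * Lie F (Lie F F) p \<and> F p * Lie F (Lie F F) p < 3 * (Lie F F p)\<^sup>2"
  defines "admissible \<equiv> \<lambda>h w.
             w 0 = u t0 \<and>
             specular_ellipse_method F t0 h (num_steps t0 T h)
               (\<lambda>n. opt_scale F (grid t0 h n, w n)) w \<and>
             (\<forall>n \<le> num_steps t0 T h. (grid t0 h n, w n) \<in> tube t0 T \<rho> u)"
  shows "\<exists>H>0. \<exists>C\<^sub>g>0. \<forall>h\<in>{0<..H}. \<exists>w :: nat \<Rightarrow> real.
           admissible h w \<and>
           (\<forall>v. admissible h v \<longrightarrow> (\<forall>n \<le> num_steps t0 T h. v n = w n)) \<and>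
           (MAX n\<in>{0..num_steps t0 T h}. \<bar>u (grid t0 h n) - w n\<bar>) \<le> C\<^sub>g * h ^ 3"
proof -

  \<comment> \<open>Uniform constants on the tube\<close>
  let ?U = "tube t0 T \<rho> u" and ?L1 = "Lie F F" and ?L2 = "Lie F (Lie F F)"
    and ?L3 = "Lie F (Lie F (Lie F F))"
  have cu: "continuous_on {t0..T} u" and uin: "\<And>t. t \<in> {t0..T} \<Longrightarrow> (t, u t) \<in> \<Omega>"
    and du: "\<And>t. t0 < t \<Longrightarrow> t < T \<Longrightarrow> (u has_real_derivative F (t, u t)) (at t)"
    using assms(6) by (auto simp: unique_ivp_solution_def ivp_solution_def)
  have C3: "C_on (Suc (Suc (Suc 0))) \<Omega> F"
    using assms(5) by (simp only: numeral_3_eq_3)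
  have C2: "C_on (Suc (Suc 0)) \<Omega> ?L1"
    by (rule C_on_Lie[OF assms(1) C_on_SucD[OF C3] C3])
  have C1: "C_on (Suc 0) \<Omega> ?L2"
    by (rule C_on_Lie[OF assms(1) C_on_SucD[OF C_on_SucD[OF C3]] C2])
  \<comment> \<open>Continuity of \<open>?L3\<close> suffices: it only bounds the derivative of the
    second slope derivative in the Taylor remainders.\<close>
  have C0: "C_on 0 \<Omega> ?L3"
    by (rule C_on_Lie[OF assms(1) C_on_SucD[OF C_on_SucD[OF C_on_SucD[OF C3]]] C1])
  note cont = C3[THEN C_on_continuous] C2[THEN C_on_continuous] C1[THEN C_on_continuous]
    C0[THEN C_on_continuous]
  have U: "compact ?U" by (rule compact_tube[OF cu])
  have contU: "continuous_on ?U F" "continuous_on ?U ?L1" "continuous_on ?U ?L2" "continuous_on ?U ?L3"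
    using cont[THEN continuous_on_subset, OF assms(9)] by blast+
  obtain B0 where B0: "0 \<le> B0" "\<And>p. p \<in> ?U \<Longrightarrow> \<bar>F p\<bar> \<le> B0"
    using compact_abs_bound[OF U contU(1)] by blast
  obtain B1 where B1: "0 \<le> B1" "\<And>p. p \<in> ?U \<Longrightarrow> \<bar>?L1 p\<bar> \<le> B1"
    using compact_abs_bound[OF U contU(2)] by blast
  obtain B2 where B2: "0 \<le> B2" "\<And>p. p \<in> ?U \<Longrightarrow> \<bar>?L2 p\<bar> \<le> B2"
    using compact_abs_bound[OF U contU(3)] by blast
  obtain B3 where B3: "0 \<le> B3" "\<And>p. p \<in> ?U \<Longrightarrow> \<bar>?L3 p\<bar> \<le> B3"
    using compact_abs_bound[OF U contU(4)] by blast
  define M where "M = B0 + B1 + B2 + B3"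
  have M0: "0 \<le> M" using B0(1) B1(1) B2(1) B3(1) by (simp add: M_def)
  have M: "\<bar>F p\<bar> \<le> M" "\<bar>?L1 p\<bar> \<le> M" "\<bar>?L2 p\<bar> \<le> M" "\<bar>?L3 p\<bar> \<le> M" if "p \<in> ?U" for p
    using B0(1) B1(1) B2(1) B3(1) B0(2)[OF that] B1(2)[OF that] B2(2)[OF that] B3(2)[OF that]
    unfolding M_def by linarith+
  have uU: "(t, u t) \<in> ?U" if "t0 \<le> t" "t \<le> T" for t
    using that assms(7) by (simp add: tube_def)
  have nz: "?L2 p \<noteq> 0" if "p \<in> ?U" for p
    using assms(11)[OF that] by auto
  have scale_pos: "0 < opt_scale F p" if "p \<in> ?U" for p
    using opt_scale_radicand_pos[of F p] assms(11)[OF that] by (simp add: opt_scale_def)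
  have scale_cont: "continuous_on ?U (opt_scale F)"
    unfolding opt_scale_def using nz by (intro continuous_intros contU) auto
  have "?U \<noteq> {}"
    using uU[of t0] assms(3) by auto
  \<comment> \<open>The minimum is attained, so its positivity is a uniform lower bound for the
    scale.\<close>
  then obtain p0 where p0: "p0 \<in> ?U" "\<And>p. p \<in> ?U \<Longrightarrow> opt_scale F p0 \<le> opt_scale F p"
    using continuous_attains_inf[OF U _ scale_cont] by blast
  define s where "s = opt_scale F p0"
  have s: "0 < s" "\<And>p. p \<in> ?U \<Longrightarrow> s \<le> opt_scale F p"
    using scale_pos p0 by (auto simp: s_def)
  have "C_on (Suc 0) \<Omega> (partial_x F)" "C_on (Suc 0) \<Omega> (partial_x ?L1)" "C_on 0 \<Omega> (partial_x ?L2)"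
    using C3 C2 C1 by auto
  note this[THEN C_on_continuous, THEN continuous_on_subset, OF assms(9)]
  then have "continuous_on ?U (opt_scale_dx F)"
    unfolding opt_scale_dx_def
    by (intro continuous_intros contU scale_cont) (use nz less_imp_neq[OF scale_pos] in auto)
  from compact_abs_bound[OF U this]
  obtain Ls where Ls: "0 \<le> Ls" "\<And>p. p \<in> ?U \<Longrightarrow> \<bar>opt_scale_dx F p\<bar> \<le> Ls"
    by blast
  have scale_Lip: "\<bar>opt_scale F (t, x) - opt_scale F (t, y)\<bar> \<le> Ls * \<bar>x - y\<bar>"
    if "(t, x) \<in> ?U" "(t, y) \<in> ?U" for t x y
  proof -
    \<comment> \<open>Each time slice of the tube is a ball, hence convex, so the derivative bound
      yields a Lipschitz bound.\<close>
    have cb: "(t, z) \<in> ?U \<longleftrightarrow> z \<in> cball (u t) \<rho>" for z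
      using that by (auto simp: tube_def dist_real_def abs_minus_commute)
    have "norm (opt_scale F (t, x) - opt_scale F (t, y)) \<le> Ls * norm (x - y)"
    proof (rule field_differentiable_bound[where S = "cball (u t) \<rho>"])
      fix z assume "z \<in> cball (u t) \<rho>"
      then have z: "(t, z) \<in> ?U" using cb by simp
      have "(t, z) \<in> \<Omega>" using z assms(9) by blast
      then have "((\<lambda>y. opt_scale F (t, y)) has_real_derivative opt_scale_dx F (t, z)) (at z)"
        using opt_scale_has_derivative_x[OF assms(1,5)] assms(11)[OF z] by simp
      then show "((\<lambda>y. opt_scale F (t, y)) has_real_derivative opt_scale_dx F (t, z)) (at z within cball (u t) \<rho>)"
        by (rule has_field_derivative_at_within)
      show "norm (opt_scale_dx F (t, z)) \<le> Ls"
        using Ls(2)[OF z] by simp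
    qed (use that cb in auto)
    then show ?thesis by simp
  qed

  \<comment> \<open>Verification of the abstract convergence hypotheses\<close>
  define K where "K = 1 + 2 * M / s"
  have K: "0 \<le> K" using M0 s by (simp add: K_def)
  define D where "D = 2 * M + 6 * M ^ 3 / s\<^sup>2 + 31 * M ^ 4 / s ^ 3"
  \<comment> \<open>The scale is frozen at the old point; the unknown \<open>y\<close> enters
    through \<open>F\<close> alone.\<close>
  define \<phi> where "\<phi> h t x y = spec_mean_scaled (opt_scale F (t, x)) (F (t + h, y)) (F (t, x))" for h t x y
  have "\<exists>H>0. \<exists>C>0. \<forall>h\<in>{0<..H}. \<exists>w :: nat \<Rightarrow> real.
      (w 0 = u t0 \<and>
       (\<forall>n<num_steps t0 T h. w (Suc n) = w n + h * \<phi> h (grid t0 h n) (w n) (w (Suc n))) \<and>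
       (\<forall>n\<le>num_steps t0 T h. (grid t0 h n, w n) \<in> ?U)) \<and>
      (\<forall>v. v 0 = u t0 \<and>
         (\<forall>n<num_steps t0 T h. v (Suc n) = v n + h * \<phi> h (grid t0 h n) (v n) (v (Suc n))) \<and>
         (\<forall>n\<le>num_steps t0 T h. (grid t0 h n, v n) \<in> ?U) \<longrightarrow>
       (\<forall>n\<le>num_steps t0 T h. v n = w n)) \<and>
      (\<forall>n\<le>num_steps t0 T h. \<bar>u (grid t0 h n) - w n\<bar> \<le> C * h ^ 3)"
  proof (rule implicit_one_step_convergence[where ?h0.0 = 1 and P = "K * (L + Ls)" and M = "2 * M" and D = D])
    fix h t x x' y y' :: real
    assume "0 < h" and x: "(t, x) \<in> ?U" "(t, x') \<in> ?U" and y: "(t + h, y) \<in> ?U" "(t + h, y') \<in> ?U"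
    have "\<bar>\<phi> h t x y - \<phi> h t x' y'\<bar> \<le> K * (\<bar>F (t + h, y) - F (t + h, y')\<bar> +
        \<bar>F (t, x) - F (t, x')\<bar> + \<bar>opt_scale F (t, x) - opt_scale F (t, x')\<bar>)"
      unfolding \<phi>_def K_def
      by (rule spec_mean_scaled_Lipschitz[OF s(1) s(2)[OF x(1)] s(2)[OF x(2)] M(1)[OF y(2)] M(1)[OF x(2)]])
    also have "\<dots> \<le> K * (L * \<bar>y - y'\<bar> + L * \<bar>x - x'\<bar> + Ls * \<bar>x - x'\<bar>)"
      by (intro mult_left_mono add_mono assms(10) scale_Lip x y K)
    also have "\<dots> \<le> K * ((L + Ls) * (\<bar>x - x'\<bar> + \<bar>y - y'\<bar>))"
      using K Ls(1) by (intro mult_left_mono) (simp_all add: algebra_simps)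
    finally show "\<bar>\<phi> h t x y - \<phi> h t x' y'\<bar> \<le> K * (L + Ls) * (\<bar>x - x'\<bar> + \<bar>y - y'\<bar>)"
      by (simp add: mult.assoc)
  next
    fix h t x y :: real
    assume "0 < h" and x: "(t, x) \<in> ?U" and y: "(t + h, y) \<in> ?U"
    let ?\<sigma> = "opt_scale F (t, x)"
    \<comment> \<open>Comparison with zero slopes, whose mean is 0; the Lipschitz bound with
      \<open>M\<close> = 0 has factor 1.\<close>
    have "\<bar>spec_mean_scaled ?\<sigma> (F (t + h, y)) (F (t, x)) - spec_mean_scaled ?\<sigma> 0 0\<bar> \<le>
        (1 + 2 * 0 / s) * (\<bar>F (t + h, y) - 0\<bar> + \<bar>F (t, x) - 0\<bar> + \<bar>?\<sigma> - ?\<sigma>\<bar>)"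
      by (rule spec_mean_scaled_Lipschitz[OF s(1) s(2)[OF x] s(2)[OF x]]) auto
    then show "\<bar>\<phi> h t x y\<bar> \<le> 2 * M"
      using M(1)[OF x] M(1)[OF y] by (simp add: \<phi>_def spec_mean_scaled_def spec_mean_def)
  next
    fix h t :: real
    assume h: "0 < h" "t0 \<le> t" "t + h \<le> T"
    \<comment> \<open>\<open>2 * M\<close> instead of \<open>M\<close>, since one constant bounds
      both the increment function and the speed of \<open>u\<close>.\<close>
    have "\<bar>u (t + h) - u t\<bar> \<le> 2 * M * (t + h - t) ^ Suc 0"
    proof (rule abs_increment_le[where b = "t + h" and g' = "\<lambda>s. F (s, u s)"])
      show "\<bar>F (r, u r)\<bar> \<le> 2 * M * (r - t) ^ 0" if "t < r" "r < t + h" for r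
        using M(1)[OF uU[of r]] M0 that h by simp
    qed (use h M0 du in \<open>auto intro: continuous_on_subset[OF cu]\<close>)
    then show "\<bar>u (t + h) - u t\<bar> \<le> 2 * M * h" by simp
  next
    fix h t :: real
    assume h: "0 < h" "h \<le> 1" "t0 \<le> t" "t + h \<le> T"
    have c: "continuous_on {t..t + h} u"
      using h by (auto intro: continuous_on_subset[OF cu])
    have cG: "continuous_on {t..t + h} (\<lambda>r. G (r, u r))" if "continuous_on \<Omega> G" for G :: "real \<times> real \<Rightarrow> real"
      by (rule continuous_on_compose2[OF that]) (use c h uin in \<open>auto intro!: continuous_intros\<close>)
    have dG: "((\<lambda>r. G (r, u r)) has_real_derivative Lie F G (r, u r)) (at r)"
      if "C_on (Suc k) \<Omega> G" "t < r" "r < t + h" for G k r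
      using has_derivative_along_solution[OF assms(1) that(1), of r u F] uin[of r] du[of r] that h
      by simp
    have b3: "\<bar>?L3 (r, u r)\<bar> \<le> M" if "t < r" "r < t + h" for r
      using M(4)[OF uU[of r]] that h by simp
    have du': "(u has_real_derivative F (r, u r)) (at r)" if "t < r" "r < t + h" for r
      using du that h by simp
    \<comment> \<open>\<open>f\<close>, \<open>f1\<close>, \<open>f2\<close>, \<open>f3\<close> are
      \<open>F\<close>, \<open>?L1\<close>, \<open>?L2\<close>, \<open>?L3\<close> along the
      solution, on the interval of one step.\<close>
    note taylor = taylor_bounds[OF _ c cG[OF cont(1)] cG[OF cont(2)] cG[OF cont(3)] du'
      dG[OF C3] dG[OF C2] dG[OF C1] b3 M0]
    have tU: "(t, u t) \<in> ?U" using uU h by simp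
    have "\<bar>u (t + h) - u t - h * \<phi> h t (u t) (u (t + h))\<bar> \<le> D * h ^ 4"
      unfolding \<phi>_def D_def
    proof (rule spec_mean_scaled_residual[OF s(1) s(2)[OF tU] h(1,2) M(1-3)[OF tU]])
      show "((opt_scale F (t, u t))\<^sup>2 + (F (t, u t))\<^sup>2) * ?L2 (t, u t) = 3 * F (t, u t) * (?L1 (t, u t))\<^sup>2"
        using opt_scale_identity[of F "(t, u t)"] assms(11)[OF tU] by blast
    qed (use taylor h in simp_all)
    then show "\<bar>u (t + h) - u t - h * \<phi> h t (u t) (u (t + h))\<bar> \<le> D * h ^ Suc 3"
      by simp
  qed (use assms(3,7,8) K M0 s Ls(1) in \<open>auto simp: D_def\<close>)
  then have "\<exists>H>0. \<exists>C>0. \<forall>h\<in>{0<..H}. \<exists>w. admissible h w \<and>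
      (\<forall>v. admissible h v \<longrightarrow> (\<forall>n\<le>num_steps t0 T h. v n = w n)) \<and>
      (\<forall>n\<le>num_steps t0 T h. \<bar>u (grid t0 h n) - w n\<bar> \<le> C * h ^ 3)"
    unfolding admissible_def specular_ellipse_method_def \<phi>_def grid_Suc .
  then obtain H C where "0 < H" "0 < C" and HC: "\<forall>h\<in>{0<..H}. \<exists>w. admissible h w \<and>
      (\<forall>v. admissible h v \<longrightarrow> (\<forall>n\<le>num_steps t0 T h. v n = w n)) \<and>
      (\<forall>n\<le>num_steps t0 T h. \<bar>u (grid t0 h n) - w n\<bar> \<le> C * h ^ 3)"
    by (elim exE conjE)
  have "\<exists>w. admissible h w \<and>
      (\<forall>v. admissible h v \<longrightarrow> (\<forall>n\<le>num_steps t0 T h. v n = w n)) \<and>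
      (MAX n\<in>{0..num_steps t0 T h}. \<bar>u (grid t0 h n) - w n\<bar>) \<le> C * h ^ 3" if h: "h \<in> {0<..H}" for h
  proof -
    obtain w where w: "admissible h w" "\<forall>v. admissible h v \<longrightarrow> (\<forall>n\<le>num_steps t0 T h. v n = w n)"
      "\<forall>n\<le>num_steps t0 T h. \<bar>u (grid t0 h n) - w n\<bar> \<le> C * h ^ 3"
      using bspec[OF HC h] by (elim exE conjE)
    have "(MAX n\<in>{0..num_steps t0 T h}. \<bar>u (grid t0 h n) - w n\<bar>) \<le> C * h ^ 3"
      using w(3) by (subst Max_le_iff) auto
    with w(1,2) show ?thesis by (intro exI[of _ w] conjI)
  qed
  then show ?thesis
    using \<open>0 < H\<close> \<open>0 < C\<close> by (intro exI[of _ H] conjI exI[of _ C] ballI)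
qed

end
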